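(* Let $\Delta>0$ and $p>0$. Suppose the times at which a web page changes form a time-homogeneous Poisson point process on $[0,\infty)$ with rate $\Delta$, and, independently, the page is accessed at times $0=t_0<t_1<t_2<\cdots$ where $\{t_k-t_{k-1}\}_{k\ge1}$ are i.i.d. exponential random variables with rate $p$. For $k\ge 1$ let $I_k=1$ if the page changed at least once in $(t_{k-1},t_k]$ and $I_k=0$ otherwise. Let $\omega>0$ be a constant, let $\{\beta_k\}_{k\ge -1}$ and $\{\eta_k\}_{k\ge0}$ be sequences of positive reals, set $\gamma_k=\eta_k/\beta_k$ and \[ \zeta_k=\frac{\beta_k-\omega\eta_k}{\beta_{k-1}},\qquad k\ge0, \] let $z_0,z_{-1}\in\mathbb{R}$, and define \[ z_{k+1}=z_k+\eta_k\big[I_{k+1}(z_k+p)-z_k\big]+\zeta_k(z_k-z_{k-1}),\qquad k\ge0. \] Then $z_k\to\Delta$ almost surely, provided one of the following holds: 1. (One-timescale) $\sum_{k\ge0}\beta_k=\infty$, $\sum_{k\ge0}\beta_k^2<\infty$, and $\beta_k=\gamma_k$ for all $k$; 2. (Two-timescale) $\sum_{k\ge0}\beta_k=\sum_{k\ge0}\gamma_k=\infty$, $\sum_{k\ge0}(\beta_k^2+\gamma_k^2)<\infty$, and $\lim_{k\to\infty}\beta_k/\gamma_k=0$.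
   Context: Here $\Delta$ is unknown (to be estimated) and $p$ is known; $z_k$ is called the SAM estimator (stochastic approximation with heavy-ball momentum). *)

theory Defs
  imports "HOL-Probability.Probability"
begin

text \<open>Change times of the page: a homogeneous Poisson point process on [0,inf) is
  represented by its arrival times, i.e. partial sums of i.i.d. exponential
  inter-arrival times X 0, X 1, ... (the (n+1)-th change happens at change_time X n).\<close>
definition change_time :: "(nat \<Rightarrow> 'a \<Rightarrow> real) \<Rightarrow> nat \<Rightarrow> 'a \<Rightarrow> real" where
  "change_time X n w = (\<Sum>i\<le>n. X i w)"

definition access_time :: "(nat \<Rightarrow> 'a \<Rightarrow> real) \<Rightarrow> nat \<Rightarrow> 'a \<Rightarrow> real" where
  "access_time Y k w = (\<Sum>i<k. Y i w)"

definition change_ind :: "(nat \<Rightarrow> 'a \<Rightarrow> real) \<Rightarrow> (nat \<Rightarrow> 'a \<Rightarrow> real) \<Rightarrow> nat \<Rightarrow> 'a \<Rightarrow> real" where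
  "change_ind X Y k w =
     (if \<exists>n. access_time Y (k - 1) w < change_time X n w \<and> change_time X n w \<le> access_time Y k w
      then 1 else 0)"

text \<open>The SAM recursion. sam_pair ... k = (z_(k-1), z_k).
  beta is indexed by integers (beta k for k >= -1), eta by naturals,
  zeta_k = (beta_k - om * eta_k) / beta_(k-1).\<close>
fun sam_pair :: "real \<Rightarrow> real \<Rightarrow> (int \<Rightarrow> real) \<Rightarrow> (nat \<Rightarrow> real) \<Rightarrow> (nat \<Rightarrow> real)
                  \<Rightarrow> real \<Rightarrow> real \<Rightarrow> nat \<Rightarrow> real \<times> real" where
  "sam_pair p om beta eta I zm1 z0 0 = (zm1, z0)"
| "sam_pair p om beta eta I zm1 z0 (Suc k) =
     (let zp = fst (sam_pair p om beta eta I zm1 z0 k);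
          zc = snd (sam_pair p om beta eta I zm1 z0 k);
          zeta = (beta (int k) - om * eta k) / beta (int k - 1)
      in (zc, zc + eta k * (I (Suc k) * (zc + p) - zc) + zeta * (zc - zp)))"

definition sam :: "real \<Rightarrow> real \<Rightarrow> (int \<Rightarrow> real) \<Rightarrow> (nat \<Rightarrow> real) \<Rightarrow> (nat \<Rightarrow> real)
                  \<Rightarrow> real \<Rightarrow> real \<Rightarrow> nat \<Rightarrow> real" where
  "sam p om beta eta I zm1 z0 k = snd (sam_pair p om beta eta I zm1 z0 k)"

end

theory Submission
  imports Defs
begin

text \<open>
  Set \<open>J k = 1 - I (k + 1)\<close>, \<open>a = p / (Delta + p)\<close>, \<open>g = eta / beta\<close>, \<open>y = z - Delta\<close>,
  \<open>x k = (z k - z (k - 1)) / beta (k - 1)\<close>. The recursion is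
  \<open>x (k + 1) = (1 - om g k) x k - g k (a y k + (J k - a) (y k + Delta + p))\<close>,
  \<open>y (k + 1) = y k + beta k x (k + 1)\<close>.

  By memorylessness the \<open>J k\<close> are independent Bernoulli variables with mean \<open>a\<close>, so
  \<open>\<Sum> g k (J k - a)\<close> converges almost surely; the rest is pathwise. The filtered noise
  \<open>n (k + 1) = (1 - om g k) n k + g k (J k - a)\<close> tends to \<open>0\<close>, and after passing to
  \<open>X = x + n (y + Delta + p)\<close>, which absorbs the multiplicative noise exactly, only perturbations
  of size \<open>o(beta)\<close> remain. A Lyapunov function of the unperturbed linear system then contracts: a
  weighted \<open>l\<^sup>1\<close> norm of \<open>y\<close> and \<open>om X + a y\<close> when \<open>beta / g\<close> tends to \<open>0\<close>, and a quadratic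
  form when \<open>beta = g\<close>.
\<close>

subsection \<open>The deterministic recursion\<close>

text \<open>Once \<open>e k < c * d / 2\<close>, the quantity \<open>L k - d / 2\<close> is at most
  multiplied by \<open>1 - c * b k <= exp (- c * b k)\<close>, and the product of these factors
  vanishes because the sum of \<open>b\<close> diverges. Every Lyapunov inequality below is turned
  into convergence by this lemma.\<close>

lemma perturbed_contraction_tendsto_0:
  fixes L b e :: "nat \<Rightarrow> real"
  assumes c: "c > 0"
    and L0: "\<And>k. L k \<ge> 0"
    and b0: "\<And>k. b k \<ge> 0"
    and bsum: "filterlim (\<lambda>n. \<Sum>k<n. b k) at_top sequentially"
    and bsmall: "\<forall>\<^sub>F k in sequentially. c * b k \<le> 1"
    and e: "e \<longlonglongrightarrow> 0"
    and step: "\<forall>\<^sub>F k in sequentially. L (Suc k) \<le> (1 - c * b k) * L k + b k * e k"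
  shows "L \<longlonglongrightarrow> 0"
proof (rule LIMSEQ_I)
  fix d :: real assume d: "d > 0"
  have "\<forall>\<^sub>F k in sequentially. e k < c * d / 2"
    using e by (rule order_tendstoD) (use c d in auto)
  with bsmall step have "\<forall>\<^sub>F k in sequentially. c * b k \<le> 1
      \<and> L (Suc k) \<le> (1 - c * b k) * L k + b k * e k \<and> e k < c * d / 2"
    by eventually_elim auto
  then obtain K where K: "\<And>k. k \<ge> K \<Longrightarrow> c * b k \<le> 1"
      "\<And>k. k \<ge> K \<Longrightarrow> L (Suc k) \<le> (1 - c * b k) * L k + b k * e k"
      "\<And>k. k \<ge> K \<Longrightarrow> e k < c * d / 2"
    unfolding eventually_sequentially by blast
  define S where "S n = (\<Sum>k<n. b k)" for n
  \<comment> \<open>The right side starts from \<open>L K\<close> instead of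
    \<open>L K - d / 2\<close>, so that it is nonnegative when \<open>1 - c * b k\<close> is
    replaced by the exponential.\<close>
  have bound: "L k - d / 2 \<le> L K * exp (- c * (S k - S K))" if "k \<ge> K" for k
    using that
  proof (induction k rule: dec_induct)
    case base
    show ?case using d by simp
  next
    case (step k)
    have "L (Suc k) \<le> (1 - c * b k) * L k + b k * e k" using K(2) step by auto
    also have "b k * e k \<le> b k * (c * d / 2)"
      using K(3)[of k] step b0[of k] by (intro mult_left_mono) auto
    finally have "L (Suc k) - d / 2 \<le> (1 - c * b k) * (L k - d / 2)"
      by (simp add: algebra_simps)
    also have "\<dots> \<le> (1 - c * b k) * (L K * exp (- c * (S k - S K)))"
      using K(1)[of k] step by (intro mult_left_mono) auto
    also have "\<dots> \<le> exp (- c * b k) * (L K * exp (- c * (S k - S K)))"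
      using exp_ge_add_one_self[of "- c * b k"] L0[of K] by (intro mult_right_mono) auto
    also have "\<dots> = L K * exp (- c * (S (Suc k) - S K))"
      by (simp add: S_def exp_add[symmetric] algebra_simps)
    finally show ?case .
  qed
  have "filterlim (\<lambda>n. - c * (S n - S K)) at_bot sequentially"
  proof -
    have "filterlim S at_top sequentially" using bsum by (simp add: S_def[abs_def])
    then have "filterlim (\<lambda>n. c * (- S K + S n)) at_top sequentially"
      by (intro filterlim_tendsto_pos_mult_at_top[OF tendsto_const c]
          filterlim_tendsto_add_at_top[OF tendsto_const])
    then show ?thesis
      unfolding filterlim_uminus_at_top by (simp add: algebra_simps)
  qed
  then have "(\<lambda>n. L K * exp (- c * (S n - S K))) \<longlonglongrightarrow> L K * 0"
    by (intro tendsto_mult tendsto_const filterlim_compose[OF exp_at_bot])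
  then have "\<forall>\<^sub>F n in sequentially. L K * exp (- c * (S n - S K)) < d / 2"
    by (rule order_tendstoD) (use d in auto)
  then obtain N where N: "\<And>n. n \<ge> N \<Longrightarrow> L K * exp (- c * (S n - S K)) < d / 2"
    unfolding eventually_sequentially by blast
  have "norm (L n - 0) < d" if "n \<ge> max K N" for n
    using bound[of n] N[of n] L0[of n] that by auto
  then show "\<exists>no. \<forall>n\<ge>no. norm (L n - 0) < d" by blast
qed

text \<open>The noise series converges only conditionally, so absolute values cannot be taken term
  by term. Adding the tail \<open>N k\<close> of the series to \<open>n k\<close> cancels the noise:
  \<open>n + N\<close> obeys the same recursion with input \<open>om * g k * N k\<close>, which is
  \<open>g k\<close> times a null sequence.\<close>

lemma filtered_noise_tendsto_0:
  fixes g xi n :: "nat \<Rightarrow> real"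
  assumes om: "om > 0"
    and g0: "\<And>k. g k \<ge> 0"
    and gsum: "filterlim (\<lambda>m. \<Sum>k<m. g k) at_top sequentially"
    and glim: "g \<longlonglongrightarrow> 0"
    and noise: "summable (\<lambda>k. g k * xi k)"
    and n: "\<And>k. n (Suc k) = (1 - om * g k) * n k + g k * xi k"
  shows "n \<longlonglongrightarrow> 0"
proof -
  define N where "N k = (\<Sum>i. g i * xi i) - (\<Sum>i<k. g i * xi i)" for k
  have "(\<lambda>k. \<Sum>i<k. g i * xi i) \<longlonglongrightarrow> (\<Sum>i. g i * xi i)"
    using noise by (rule summable_LIMSEQ)
  then have N: "N \<longlonglongrightarrow> 0"
    unfolding N_def[abs_def] by (auto intro!: tendsto_eq_intros)
  have small: "\<forall>\<^sub>F k in sequentially. om * g k \<le> 1"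
  proof -
    have "\<forall>\<^sub>F k in sequentially. g k < 1 / om"
      using glim by (rule order_tendstoD) (use om in auto)
    then show ?thesis
      by eventually_elim (use om in \<open>simp add: field_simps\<close>)
  qed
  have "(\<lambda>k. \<bar>n k + N k\<bar>) \<longlonglongrightarrow> 0"
  proof (rule perturbed_contraction_tendsto_0[OF om _ g0 gsum small])
    show "(\<lambda>k. om * \<bar>N k\<bar>) \<longlonglongrightarrow> 0"
      using N by (auto intro!: tendsto_eq_intros)
    show "\<forall>\<^sub>F k in sequentially.
        \<bar>n (Suc k) + N (Suc k)\<bar> \<le> (1 - om * g k) * \<bar>n k + N k\<bar> + g k * (om * \<bar>N k\<bar>)"
      using small
    proof eventually_elim
      case (elim k)
      have "n (Suc k) + N (Suc k) = (1 - om * g k) * (n k + N k) + g k * (om * N k)"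
        by (simp add: n N_def algebra_simps)
      also have "\<bar>\<dots>\<bar> \<le> \<bar>(1 - om * g k) * (n k + N k)\<bar> + \<bar>g k * (om * N k)\<bar>"
        by (rule abs_triangle_ineq)
      finally show ?case using elim g0[of k] om by (simp add: abs_mult)
    qed
  qed auto
  then have "(\<lambda>k. (n k + N k) - N k) \<longlonglongrightarrow> 0 - 0"
    using N by (intro tendsto_diff) (auto simp: tendsto_rabs_zero_iff)
  then show ?thesis by simp
qed

text \<open>\<open>u\<close> is the scaled distance of \<open>X\<close> from the quasi-equilibrium
  \<open>- (a / om) * y\<close>. It relaxes at the fast rate \<open>om * g k\<close>, while
  \<open>y\<close> then contracts at the slow rate \<open>(a / om) * b k\<close>. Each feeds into
  the other only with weight \<open>b k\<close>, which is negligible against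
  \<open>g k\<close>.\<close>

lemma two_timescale_tendsto_0:
  fixes X y n b g :: "nat \<Rightarrow> real"
  assumes pos: "om > 0" "a > 0" "c > 0"
    and b0: "\<And>k. b k > 0" and g0: "\<And>k. g k > 0"
    and bsum: "filterlim (\<lambda>m. \<Sum>k<m. b k) at_top sequentially"
    and blim: "b \<longlonglongrightarrow> 0" and glim: "g \<longlonglongrightarrow> 0" and nlim: "n \<longlonglongrightarrow> 0"
    and bg: "(\<lambda>k. b k / g k) \<longlonglongrightarrow> 0"
    and h: "\<And>k. h k = (1 - om * g k) * X k - a * g k * y k - n (Suc k) * (y k + c)"
    and X: "\<And>k. X (Suc k) = (1 - om * g k) * X k - a * g k * y k + n (Suc k) * b k * h k"
    and y: "\<And>k. y (Suc k) = y k + b k * h k"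
  shows "y \<longlonglongrightarrow> 0"
proof -
  define u where "u k = om * X k + a * y k" for k
  \<comment> \<open>With this weight the influence of \<open>y\<close> on \<open>u\<close> costs
    \<open>4 * a^2 * D * b k / om = a / (4 * om) * b k\<close>, half of the contraction
    \<open>a / (2 * om) * b k\<close> available for \<open>y\<close>.\<close>
  define D where "D = 1 / (16 * a)"
  have D: "D > 0" using pos by (simp add: D_def)
  have n1: "(\<lambda>k. n (Suc k)) \<longlonglongrightarrow> 0" using nlim by (rule LIMSEQ_Suc)
  \<comment> \<open>In the last bound the three summands of the denominator stand for the influence
    of \<open>u\<close> on \<open>y\<close>, the influence of \<open>u\<close> on itself through
    \<open>h\<close>, and the contraction to be retained; together they must not exceed
    \<open>D * om * g k\<close>.\<close>
  have ev: "\<forall>\<^sub>F k in sequentially. \<bar>n (Suc k)\<bar> < a / (2 * om) \<and> g k < 1 / om \<and> b k < om / (2 * a)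
      \<and> b k / g k < D * om / (1 / om + 2 * a * D / om + D * a / (4 * om))"
    (is "\<forall>\<^sub>F k in sequentially. ?E k")
    using pos D
    by (intro eventually_conj order_tendstoD(2)[OF blim] order_tendstoD(2)[OF glim]
        order_tendstoD(2)[OF bg] order_tendstoD(2)[OF tendsto_rabs_zero[OF n1]])
       (auto intro!: divide_pos_pos add_pos_pos)
  \<comment> \<open>Substituting \<open>X k = (u k - a * y k) / om\<close> cancels the terms in
    \<open>g k * y k\<close> and exposes the averaged drift \<open>- (a / om) * y k\<close>.\<close>
  have hu: "h k = (1 / om - g k) * u k - (a / om) * y k - n (Suc k) * (y k + c)" for k
    using pos by (simp add: h u_def field_simps)
  have uS: "u (Suc k) = (1 - om * g k) * u k + (a + om * n (Suc k)) * b k * h k" for k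
    by (simp add: u_def X y algebra_simps)
  have "(\<lambda>k. \<bar>y k\<bar> + D * \<bar>u k\<bar>) \<longlonglongrightarrow> 0"
  proof (rule perturbed_contraction_tendsto_0[where c = "a / (4 * om)" and b = b
        and e = "\<lambda>k. c * \<bar>n (Suc k)\<bar> * (1 + 2 * a * D)"])
    show "(\<lambda>k. c * \<bar>n (Suc k)\<bar> * (1 + 2 * a * D)) \<longlonglongrightarrow> 0"
      using n1 by (auto intro!: tendsto_eq_intros)
    show "\<forall>\<^sub>F k in sequentially. a / (4 * om) * b k \<le> 1"
      using ev
    proof eventually_elim
      case (elim k)
      then have "b k \<le> om / (2 * a)" by auto
      also have "\<dots> \<le> 4 * om / a" using pos by (simp add: field_simps)
      finally show ?case using pos by (simp add: field_simps)
    qed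
    show "\<forall>\<^sub>F k in sequentially. \<bar>y (Suc k)\<bar> + D * \<bar>u (Suc k)\<bar>
        \<le> (1 - a / (4 * om) * b k) * (\<bar>y k\<bar> + D * \<bar>u k\<bar>) + b k * (c * \<bar>n (Suc k)\<bar> * (1 + 2 * a * D))"
      using ev
    proof eventually_elim
      case (elim k)
      let ?n = "n (Suc k)"
      note bk = b0[of k] and gk = g0[of k]
      have n_small: "\<bar>?n\<bar> \<le> a / (2 * om)" using elim by auto
      have g_small: "0 \<le> 1 / om - g k" "1 / om - g k \<le> 1 / om" using elim gk by auto
      have g_small': "0 \<le> 1 - om * g k" using elim pos by (auto simp: field_simps)
      have coef: "\<bar>1 - b k * (a / om + ?n)\<bar> \<le> 1 - b k * (a / (2 * om))"
      proof -
        have lo: "a / om + ?n \<ge> a / (2 * om)" using n_small pos by (auto simp: field_simps abs_le_iff)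
        have "a / om + ?n \<le> 3 * a / (2 * om)" using n_small pos by (auto simp: field_simps abs_le_iff)
        then have "b k * (a / om + ?n) \<le> b k * (3 * a / (2 * om))"
          using bk by (intro mult_left_mono) auto
        \<comment> \<open>This sum is the origin of the threshold \<open>om / (2 * a)\<close> for
          \<open>b k\<close>: it keeps \<open>y\<close> from overshooting zero by too much.\<close>
        moreover have "b k * (3 * a / (2 * om)) + b k * (a / (2 * om)) = b k * (2 * a / om)"
          using pos by (simp add: field_simps)
        moreover have "b k * (2 * a / om) \<le> 1" using elim pos by (auto simp: field_simps)
        moreover have "b k * (a / (2 * om)) \<le> b k * (a / om + ?n)"
          using bk lo by (intro mult_left_mono) auto
        ultimately show ?thesis by (simp add: abs_le_iff)
      qed
      have "y (Suc k) = (1 - b k * (a / om + ?n)) * y k + b k * ((1 / om - g k) * u k) - b k * (?n * c)"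
        unfolding y hu by (simp add: algebra_simps)
      also have "\<bar>\<dots>\<bar> \<le> \<bar>1 - b k * (a / om + ?n)\<bar> * \<bar>y k\<bar> + b k * ((1 / om - g k) * \<bar>u k\<bar>) + b k * (\<bar>?n\<bar> * c)"
        using bk g_small pos by (intro order.trans[OF abs_triangle_ineq4] add_mono
            order.trans[OF abs_triangle_ineq]) (auto simp: abs_mult)
      also have "\<dots> \<le> (1 - b k * (a / (2 * om))) * \<bar>y k\<bar> + b k * (1 / om * \<bar>u k\<bar>) + b k * (\<bar>?n\<bar> * c)"
        using bk g_small coef by (intro add_mono mult_right_mono mult_left_mono) auto
      finally have yb: "\<bar>y (Suc k)\<bar> \<le> \<dots>" .
      have hb: "\<bar>h k\<bar> \<le> 1 / om * \<bar>u k\<bar> + 2 * a / om * \<bar>y k\<bar> + \<bar>?n\<bar> * c"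
      proof -
        have "h k = (1 / om - g k) * u k - (a / om + ?n) * y k - ?n * c"
          by (simp add: hu algebra_simps)
        also have "\<bar>\<dots>\<bar> \<le> (1 / om - g k) * \<bar>u k\<bar> + \<bar>a / om + ?n\<bar> * \<bar>y k\<bar> + \<bar>?n\<bar> * c"
          using g_small pos by (intro order.trans[OF abs_triangle_ineq4] add_mono
            order.trans[OF abs_triangle_ineq4]) (auto simp: abs_mult)
        also have "\<dots> \<le> 1 / om * \<bar>u k\<bar> + 2 * a / om * \<bar>y k\<bar> + \<bar>?n\<bar> * c"
        proof -
          have "\<bar>a / om + ?n\<bar> \<le> 2 * a / om" using n_small pos by (auto simp: field_simps abs_le_iff)
          then show ?thesis using g_small pos by (intro add_mono mult_right_mono) auto
        qed
        finally show ?thesis .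
      qed
      have acoef: "\<bar>a + om * ?n\<bar> \<le> 2 * a" using n_small pos by (auto simp: field_simps abs_le_iff)
      have "\<bar>u (Suc k)\<bar> \<le> (1 - om * g k) * \<bar>u k\<bar> + \<bar>a + om * ?n\<bar> * b k * \<bar>h k\<bar>"
        unfolding uS using g_small' bk
        by (intro order.trans[OF abs_triangle_ineq] add_mono) (auto simp: abs_mult)
      also have "\<dots> \<le> (1 - om * g k) * \<bar>u k\<bar> + 2 * a * b k * (1 / om * \<bar>u k\<bar> + 2 * a / om * \<bar>y k\<bar> + \<bar>?n\<bar> * c)"
        using acoef hb bk pos by (intro add_left_mono mult_mono) auto
      finally have ub: "\<bar>u (Suc k)\<bar> \<le> \<dots>" .
      have key: "b k * (1 / om + 2 * a * D / om + D * a / (4 * om)) \<le> D * om * g k"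
      proof -
        have q: "1 / om + 2 * a * D / om + D * a / (4 * om) > 0"
          using pos D by (intro add_pos_pos) auto
        then have "b k / g k * (1 / om + 2 * a * D / om + D * a / (4 * om)) \<le> D * om"
          using elim by (simp add: less_divide_eq)
        then show ?thesis using gk by (simp add: field_simps)
      qed
      have "\<bar>y (Suc k)\<bar> + D * \<bar>u (Suc k)\<bar> \<le> ((1 - b k * (a / (2 * om))) * \<bar>y k\<bar> + b k * (1 / om * \<bar>u k\<bar>) + b k * (\<bar>?n\<bar> * c))
          + D * ((1 - om * g k) * \<bar>u k\<bar> + 2 * a * b k * (1 / om * \<bar>u k\<bar> + 2 * a / om * \<bar>y k\<bar> + \<bar>?n\<bar> * c))"
        using yb ub D by (intro add_mono mult_left_mono) auto
      also have "\<dots> = (1 - b k * (a / (2 * om)) + D * 4 * a\<^sup>2 * b k / om) * \<bar>y k\<bar>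
          + (D - D * om * g k + b k * (1 / om + 2 * a * D / om)) * \<bar>u k\<bar>
          + b k * (c * \<bar>?n\<bar> * (1 + 2 * a * D))"
        by (simp add: algebra_simps power2_eq_square)
      also have "1 - b k * (a / (2 * om)) + D * 4 * a\<^sup>2 * b k / om = 1 - a / (4 * om) * b k"
        using pos by (simp add: D_def field_simps power2_eq_square)
      finally have "\<bar>y (Suc k)\<bar> + D * \<bar>u (Suc k)\<bar> \<le> (1 - a / (4 * om) * b k) * \<bar>y k\<bar>
          + (D - D * om * g k + b k * (1 / om + 2 * a * D / om)) * \<bar>u k\<bar>
          + b k * (c * \<bar>?n\<bar> * (1 + 2 * a * D))" .
      moreover have "(D - D * om * g k + b k * (1 / om + 2 * a * D / om)) * \<bar>u k\<bar>
          \<le> (D - D * (a / (4 * om) * b k)) * \<bar>u k\<bar>"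
        using key by (intro mult_right_mono) (auto simp: algebra_simps)
      moreover have "(1 - a / (4 * om) * b k) * (\<bar>y k\<bar> + D * \<bar>u k\<bar>)
          = (1 - a / (4 * om) * b k) * \<bar>y k\<bar> + (D - D * (a / (4 * om) * b k)) * \<bar>u k\<bar>"
        by (simp add: algebra_simps add_divide_distrib)
      \<comment> \<open>Stated for variables, so that linear arithmetic sees the large products as
        atoms.\<close>
      moreover have "A \<le> B + C + E \<Longrightarrow> C \<le> C' \<Longrightarrow> F = B + C' \<Longrightarrow> A \<le> F + E" for A B C C' E F :: real
        by linarith
      ultimately show ?case by blast
    qed
  qed (use pos D b0 bsum in \<open>auto intro: less_imp_le\<close>)
  then show ?thesis
  proof (rule Lim_null_comparison[rotated])
    show "\<forall>\<^sub>F k in sequentially. norm (y k) \<le> \<bar>y k\<bar> + D * \<bar>u k\<bar>"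
      using D by simp
  qed
qed

text \<open>With equal step sizes the recursion is an Euler scheme of step \<open>g k\<close> for a
  damped oscillator. The perturbation of its vector field is of size
  \<open>t k * (1 + |X k| + |y k|)\<close> with \<open>t k\<close> tending to 0, so a quadratic
  Lyapunov function still contracts.\<close>

lemma one_timescale_tendsto_0:
  fixes X y n g :: "nat \<Rightarrow> real"
  assumes pos: "om > 0" "a > 0" "c > 0"
    and g0: "\<And>k. g k > 0"
    and gsum: "filterlim (\<lambda>m. \<Sum>k<m. g k) at_top sequentially"
    and glim: "g \<longlonglongrightarrow> 0" and nlim: "n \<longlonglongrightarrow> 0"
    and h: "\<And>k. h k = (1 - om * g k) * X k - a * g k * y k - n (Suc k) * (y k + c)"
    and X: "\<And>k. X (Suc k) = (1 - om * g k) * X k - a * g k * y k + n (Suc k) * g k * h k"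
    and y: "\<And>k. y (Suc k) = y k + g k * h k"
  shows "y \<longlonglongrightarrow> 0"
proof -
  text \<open>A Lyapunov function of the damped oscillator \<open>X' = - om X - a y\<close>, \<open>y' = X\<close>:
    along its flow \<open>V' = - 2 om (X\<^sup>2 + a y\<^sup>2)\<close>.\<close>
  define V where "V x z = (x + om * z)\<^sup>2 + x\<^sup>2 + 2 * a * z\<^sup>2" for x z
  \<comment> \<open>\<open>K\<close> bounds the vector field and its errors relative to
    \<open>r = 1 + |X k| + |y k|\<close>, and \<open>P\<close> bounds the bilinear form of
    \<open>V\<close> in the maximum norm. \<open>Q\<close> collects the first-order error
    \<open>2 * K * P\<close> and the second-order error \<open>4 * K^2 * P\<close>.
    \<open>C1\<close> and \<open>C2\<close> compare \<open>V\<close> with sums of squares.\<close>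
  define K where "K = 2 + om + a + c"
  define P where "P = (1 + om)\<^sup>2 + 1 + 2 * a"
  define Q where "Q = (4 * K\<^sup>2 + 2 * K) * P"
  define C1 where "C1 = 1 + 1 / (2 * a)"
  define C2 where "C2 = 3 + (2 * om\<^sup>2 + 2 * a) / a"
  define t where "t k = g k + \<bar>n (Suc k)\<bar>" for k
  have K: "K > 0" and P: "P > 0" and C1: "C1 > 0" and C2: "C2 > 0"
    using pos by (auto simp: K_def P_def C1_def C2_def intro!: add_pos_pos divide_pos_pos)
  then have Q: "Q > 0" by (auto simp: Q_def intro!: add_pos_pos mult_pos_pos)
  have n1: "(\<lambda>k. n (Suc k)) \<longlonglongrightarrow> 0" using nlim by (rule LIMSEQ_Suc)
  have tlim: "t \<longlonglongrightarrow> 0"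
    unfolding t_def[abs_def] using tendsto_add[OF glim tendsto_rabs_zero[OF n1]] by simp
  have V_nonneg: "V x z \<ge> 0" for x z
    using pos by (simp add: V_def)
  have V_lower: "x\<^sup>2 + z\<^sup>2 \<le> C1 * V x z" for x z
  proof -
    have "x\<^sup>2 \<le> V x z" using pos by (simp add: V_def)
    moreover have "2 * a * z\<^sup>2 \<le> V x z" by (simp add: V_def)
    then have "z\<^sup>2 \<le> 1 / (2 * a) * V x z" using pos by (simp add: field_simps)
    ultimately show ?thesis by (simp add: C1_def algebra_simps)
  qed
  have V_upper: "V x z \<le> C2 * (x\<^sup>2 + a * z\<^sup>2)" for x z
  proof -
    have "2 * (x * (om * z)) \<le> x\<^sup>2 + (om * z)\<^sup>2"
      using sum_squares_bound[of x "om * z"] by simp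
    then have "V x z \<le> 3 * x\<^sup>2 + (2 * om\<^sup>2 + 2 * a) * z\<^sup>2"
      by (simp add: V_def power2_sum power_mult_distrib algebra_simps)
    also have "\<dots> = 3 * x\<^sup>2 + (2 * om\<^sup>2 + 2 * a) / a * (a * z\<^sup>2)"
      using pos by simp
    also have "\<dots> \<le> C2 * x\<^sup>2 + C2 * (a * z\<^sup>2)"
      using pos by (intro add_mono mult_right_mono) (auto simp: C2_def)
    finally show ?thesis by (simp add: algebra_simps)
  qed
  \<comment> \<open>The factor 3 comes from
    \<open>(1 + x + z)^2 <= 3 * (1 + x^2 + z^2)\<close>.\<close>
  define e where "e k = 3 * Q * t k" for k
  have elim0: "e \<longlonglongrightarrow> 0" unfolding e_def[abs_def] using tlim by (auto intro!: tendsto_eq_intros)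
  \<comment> \<open>Half of the decay rate \<open>2 * om / C2\<close> given by
    \<open>V_upper\<close>; the other half pays for the error proportional to
    \<open>V\<close>.\<close>
  define c0 where "c0 = om / C2"
  have c0: "c0 > 0" using pos C2 by (simp add: c0_def)
  have "(\<lambda>k. V (X k) (y k)) \<longlonglongrightarrow> 0"
  proof (rule perturbed_contraction_tendsto_0[OF c0 V_nonneg less_imp_le[OF g0] gsum _ elim0])
    show "\<forall>\<^sub>F k in sequentially. c0 * g k \<le> 1"
    proof -
      have "\<forall>\<^sub>F k in sequentially. g k < 1 / c0"
        using glim by (rule order_tendstoD) (use c0 in auto)
      then show ?thesis
        by eventually_elim (use c0 in \<open>simp add: field_simps\<close>)
    qed
    have "\<forall>\<^sub>F k in sequentially. t k < 1 \<and> e k < c0 / C1"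
      using c0 C1 by (intro eventually_conj order_tendstoD(2)[OF tlim] order_tendstoD(2)[OF elim0]) auto
    then show "\<forall>\<^sub>F k in sequentially. V (X (Suc k)) (y (Suc k)) \<le> (1 - c0 * g k) * V (X k) (y k) + g k * e k"
    proof eventually_elim
      case (elim k)
      note gk = g0[of k]
      let ?n = "n (Suc k)"
      define r where "r = 1 + \<bar>X k\<bar> + \<bar>y k\<bar>"
      \<comment> \<open>\<open>e1\<close> and \<open>e2\<close> are the deviations of the increments
        of \<open>X\<close> and \<open>y\<close>, per unit of \<open>g k\<close>, from the
        oscillator field \<open>(- om * X k - a * y k, X k)\<close>.\<close>
      define e1 where "e1 = ?n * h k"
      define e2 where "e2 = - (g k * (om * X k + a * y k)) - ?n * (y k + c)"
      have g1: "g k \<le> 1" and n_le1: "\<bar>?n\<bar> \<le> 1" and tk: "t k > 0" "g k \<le> t k" "\<bar>?n\<bar> \<le> t k"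
        using elim gk by (auto simp: t_def)
      have xr: "\<bar>X k\<bar> \<le> r" and yr: "\<bar>y k\<bar> \<le> r" and r1: "1 \<le> r"
        by (auto simp: r_def)
      have lin: "\<bar>om * X k + a * y k\<bar> \<le> (om + a) * r"
      proof -
        have "\<bar>om * X k + a * y k\<bar> \<le> om * \<bar>X k\<bar> + a * \<bar>y k\<bar>"
          using pos by (intro order.trans[OF abs_triangle_ineq]) (auto simp: abs_mult)
        also have "\<dots> \<le> om * r + a * r" using pos xr yr by (intro add_mono mult_left_mono) auto
        finally show ?thesis by (simp add: algebra_simps)
      qed
      have yc: "\<bar>y k + c\<bar> \<le> (1 + c) * r"
      proof -
        have "\<bar>y k + c\<bar> \<le> r + c * 1" using pos yr by auto
        also have "\<dots> \<le> r + c * r" using pos r1 by (intro add_mono mult_left_mono) auto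
        finally show ?thesis by (simp add: algebra_simps)
      qed
      have e2b: "\<bar>e2\<bar> \<le> t k * (K * r)"
      proof -
        have "\<bar>e2\<bar> \<le> g k * \<bar>om * X k + a * y k\<bar> + \<bar>?n\<bar> * \<bar>y k + c\<bar>"
          unfolding e2_def using gk by (intro order.trans[OF abs_triangle_ineq4]) (auto simp: abs_mult)
        also have "\<dots> \<le> t k * ((om + a) * r) + t k * ((1 + c) * r)"
          using tk gk lin yc by (intro add_mono mult_mono) auto
        also have "\<dots> \<le> t k * (K * r)" using tk r1 by (simp add: K_def algebra_simps)
        finally show ?thesis .
      qed
      have h_eq: "h k = X k + e2" by (simp add: h e2_def algebra_simps)
      have hb: "\<bar>h k\<bar> \<le> K * r"
      proof -
        have "\<bar>h k\<bar> \<le> \<bar>X k\<bar> + (g k * \<bar>om * X k + a * y k\<bar> + \<bar>?n\<bar> * \<bar>y k + c\<bar>)"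
          unfolding h_eq e2_def using gk by (intro order.trans[OF abs_triangle_ineq] add_mono
              order.trans[OF abs_triangle_ineq4]) (auto simp: abs_mult)
        also have "\<dots> \<le> r + (1 * ((om + a) * r) + 1 * ((1 + c) * r))"
          using gk lin yc g1 n_le1 xr by (intro add_mono mult_mono) auto
        finally show ?thesis by (simp add: K_def algebra_simps)
      qed
      have e1b: "\<bar>e1\<bar> \<le> t k * (K * r)"
        unfolding e1_def abs_mult using tk hb by (intro mult_mono) auto
      have e1b': "\<bar>e1\<bar> \<le> K * r"
        using mult_mono[OF n_le1 hb] by (simp add: e1_def abs_mult)
      define p1 where "p1 = - om * X k - a * y k + e1"
      define p2 where "p2 = X k + e2"
      have XS: "X (Suc k) = X k + g k * p1"
        by (simp add: X p1_def e1_def algebra_simps)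
      have yS: "y (Suc k) = y k + g k * p2"
        by (simp add: y p2_def h_eq)
      have "(om + a) * r \<le> K * r" using r1 pos by (intro mult_right_mono) (auto simp: K_def)
      then have p1b: "\<bar>p1\<bar> \<le> 2 * K * r" unfolding p1_def using lin e1b' by linarith
      have p2b: "\<bar>p2\<bar> \<le> 2 * K * r"
        using hb K r1 by (simp add: p2_def h_eq[symmetric])
      \<comment> \<open>This is the symmetric bilinear form of \<open>V\<close>. It is applied to
        the state against \<open>(e1, e2)\<close> for the first-order error and to
        \<open>(p1, p2)\<close> twice for the second-order term.\<close>
      have Vbound: "\<bar>(v1 + om * v2) * (w1 + om * w2) + v1 * w1 + 2 * a * v2 * w2\<bar> \<le> P * (A * B)"
        if "\<bar>v1\<bar> \<le> A" "\<bar>v2\<bar> \<le> A" "\<bar>w1\<bar> \<le> B" "\<bar>w2\<bar> \<le> B" for v1 v2 w1 w2 A B :: real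
      proof -
        have A: "\<bar>v1 + om * v2\<bar> \<le> (1 + om) * A" if "\<bar>v1\<bar> \<le> A" "\<bar>v2\<bar> \<le> A" for v1 v2 A :: real
        proof -
          have "\<bar>v1 + om * v2\<bar> \<le> \<bar>v1\<bar> + om * \<bar>v2\<bar>"
            using pos by (intro order.trans[OF abs_triangle_ineq]) (auto simp: abs_mult)
          also have "\<dots> \<le> A + om * A" using that pos by (intro add_mono mult_left_mono) auto
          finally show ?thesis by (simp add: algebra_simps)
        qed
        have nonneg: "A \<ge> 0" "B \<ge> 0" using that by auto
        have "\<bar>(v1 + om * v2) * (w1 + om * w2) + v1 * w1 + 2 * a * v2 * w2\<bar>
            \<le> \<bar>v1 + om * v2\<bar> * \<bar>w1 + om * w2\<bar> + \<bar>v1\<bar> * \<bar>w1\<bar> + 2 * a * (\<bar>v2\<bar> * \<bar>w2\<bar>)"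
          using pos by (intro order.trans[OF abs_triangle_ineq] add_mono
              order.trans[OF abs_triangle_ineq]) (auto simp: abs_mult)
        also have "\<dots> \<le> ((1 + om) * A) * ((1 + om) * B) + A * B + 2 * a * (A * B)"
          using A[OF that(1,2)] A[OF that(3,4)] that nonneg pos
          by (intro add_mono mult_mono mult_left_mono) auto
        also have "\<dots> = P * (A * B)" by (simp add: P_def power2_eq_square algebra_simps)
        finally show ?thesis .
      qed
      \<comment> \<open>The second-order Taylor expansion is exact because \<open>V\<close> is
        quadratic.\<close>
      have "V (X (Suc k)) (y (Suc k)) = V (X k) (y k) - 2 * om * g k * ((X k)\<^sup>2 + a * (y k)\<^sup>2)
          + 2 * g k * ((X k + om * y k) * (e1 + om * e2) + X k * e1 + 2 * a * y k * e2)
          + (g k)\<^sup>2 * ((p1 + om * p2) * (p1 + om * p2) + p1 * p1 + 2 * a * p2 * p2)"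
        unfolding XS yS V_def p1_def p2_def by algebra
      also have "\<dots> \<le> V (X k) (y k) - 2 * om * g k * ((X k)\<^sup>2 + a * (y k)\<^sup>2)
          + 2 * g k * (P * (r * (t k * (K * r))))
          + (g k)\<^sup>2 * (P * ((2 * K * r) * (2 * K * r)))"
        using gk abs_le_D1[OF Vbound[OF xr yr e1b e2b]] abs_le_D1[OF Vbound[OF p1b p2b p1b p2b]]
        by (intro add_mono mult_left_mono) auto
      \<comment> \<open>\<open>g k <= t k\<close> lets the second-order Euler error join the
        perturbation error.\<close>
      also have "\<dots> \<le> V (X k) (y k) - 2 * om * g k * ((X k)\<^sup>2 + a * (y k)\<^sup>2)
          + 2 * g k * (P * (r * (t k * (K * r))))
          + (g k * t k) * (P * ((2 * K * r) * (2 * K * r)))"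
        using gk tk P K by (intro add_left_mono mult_right_mono) (auto simp: power2_eq_square)
      also have "\<dots> = V (X k) (y k) - 2 * om * g k * ((X k)\<^sup>2 + a * (y k)\<^sup>2) + g k * t k * Q * r\<^sup>2"
        by (simp add: Q_def power2_eq_square algebra_simps)
      finally have VS: "V (X (Suc k)) (y (Suc k)) \<le> \<dots>" .
      have "2 * om * g k * (V (X k) (y k) / C2) \<le> 2 * om * g k * ((X k)\<^sup>2 + a * (y k)\<^sup>2)"
        using V_upper[of "X k" "y k"] C2 gk pos by (intro mult_left_mono) (auto simp: field_simps)
      moreover have "r\<^sup>2 \<le> 3 * (1 + C1 * V (X k) (y k))"
      proof -
        have "(1 + x + z)\<^sup>2 \<le> 3 * (1 + x\<^sup>2 + z\<^sup>2)" for x z :: real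
          using zero_le_power2[of "1 - x"] zero_le_power2[of "1 - z"] zero_le_power2[of "x - z"]
          by (simp add: power2_eq_square algebra_simps)
        from this[of "\<bar>X k\<bar>" "\<bar>y k\<bar>"]
        have "r\<^sup>2 \<le> 3 * (1 + (X k)\<^sup>2 + (y k)\<^sup>2)" by (simp add: r_def)
        then show ?thesis using V_lower[of "X k" "y k"] by simp
      qed
      then have "g k * t k * Q * r\<^sup>2 \<le> g k * t k * Q * (3 * (1 + C1 * V (X k) (y k)))"
        using gk tk Q by (intro mult_left_mono) auto
      ultimately have "V (X (Suc k)) (y (Suc k)) \<le> V (X k) (y k) - 2 * om * g k * (V (X k) (y k) / C2)
          + g k * t k * Q * (3 * (1 + C1 * V (X k) (y k)))"
        using VS by linarith
      also have "\<dots> = V (X k) (y k) - 2 * c0 * g k * V (X k) (y k) + (e k * C1) * (g k * V (X k) (y k)) + g k * e k"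
        by (simp add: c0_def e_def algebra_simps)
      finally have "V (X (Suc k)) (y (Suc k)) \<le> \<dots>" .
      moreover have "(e k * C1) * (g k * V (X k) (y k)) \<le> c0 * (g k * V (X k) (y k))"
        using elim C1 gk V_nonneg by (intro mult_right_mono) (auto simp: field_simps)
      ultimately show ?case by (simp add: algebra_simps)
    qed
  qed
  then have "(\<lambda>k. C1 * V (X k) (y k)) \<longlonglongrightarrow> 0"
    by (auto intro!: tendsto_eq_intros)
  then have "(\<lambda>k. (y k)\<^sup>2) \<longlonglongrightarrow> 0"
  proof (rule Lim_null_comparison[rotated])
    show "\<forall>\<^sub>F k in sequentially. norm ((y k)\<^sup>2) \<le> C1 * V (X k) (y k)"
      using V_lower by (intro always_eventually allI)
         (smt (verit) norm_power real_norm_def power2_abs zero_le_power2)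
  qed
  then show ?thesis by simp
qed


text \<open>\<open>x\<close> is the velocity of \<open>z\<close> in units of the step
  \<open>b\<close>, and \<open>J\<close> is the indicator of no change. Recentring at
  \<open>Delta\<close> and removing the noise brings both step-size regimes to the form of the two
  preceding lemmas.\<close>

lemma heavy_ball_tendsto:
  fixes x z b g J :: "nat \<Rightarrow> real"
  assumes pos: "om > 0" "p > 0" "Delta > 0"
    and b0: "\<And>k. b k > 0" and g0: "\<And>k. g k > 0"
    and steps:
      "(filterlim (\<lambda>n. \<Sum>k<n. b k) at_top sequentially \<and> b \<longlonglongrightarrow> 0 \<and> g = b)
       \<or> (filterlim (\<lambda>n. \<Sum>k<n. b k) at_top sequentially
         \<and> filterlim (\<lambda>n. \<Sum>k<n. g k) at_top sequentially
         \<and> b \<longlonglongrightarrow> 0 \<and> g \<longlonglongrightarrow> 0 \<and> (\<lambda>k. b k / g k) \<longlonglongrightarrow> 0)"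
    and noise: "summable (\<lambda>k. g k * (J k - p / (Delta + p)))"
    and x: "\<And>k. x (Suc k) = (1 - om * g k) * x k + g k * ((1 - J k) * (z k + p) - z k)"
    and z: "\<And>k. z (Suc k) = z k + b k * x (Suc k)"
  shows "z \<longlonglongrightarrow> Delta"
proof -
  define a where "a = p / (Delta + p)"
  define c where "c = Delta + p"
  define y where "y k = z k - Delta" for k
  define n where "n = rec_nat 0 (\<lambda>k r. (1 - om * g k) * r + g k * (J k - a))"
  have nS: "n (Suc k) = (1 - om * g k) * n k + g k * (J k - a)" for k
    by (simp add: n_def)
  \<comment> \<open>A discrete product rule: the increment of \<open>n\<close> times
    \<open>y k + c\<close> cancels the noise in \<open>x (Suc k)\<close>, and only
    \<open>n (Suc k)\<close> times the increment \<open>b k * h k\<close> of \<open>y\<close>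
    remains.\<close>
  define X where "X k = x k + n k * (y k + c)" for k
  define h where "h k = (1 - om * g k) * X k - a * g k * y k - n (Suc k) * (y k + c)" for k
  have a: "a > 0" and c: "c > 0" using pos by (auto simp: a_def c_def)
  \<comment> \<open>This puts the zero of the mean drift at \<open>Delta\<close>:
    \<open>p - a * (y + c) = - a * y\<close>.\<close>
  have ac: "p = a * c" using pos by (simp add: a_def c_def)
  have yc: "z k + p = y k + c" for k by (simp add: y_def c_def)
  have xS: "x (Suc k) = (1 - om * g k) * x k - g k * (a * y k + (J k - a) * (y k + c))" for k
  proof -
    have "(1 - J k) * (z k + p) - z k = p - J k * (z k + p)"
      by (simp add: algebra_simps)
    also have "\<dots> = a * c - J k * (y k + c)"
      by (simp add: ac[symmetric] yc)
    also have "\<dots> = - (a * y k + (J k - a) * (y k + c))" by (simp add: algebra_simps)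
    finally show ?thesis unfolding x by (simp add: right_diff_distrib distrib_left)
  qed
  have xh: "x (Suc k) = h k" for k
    unfolding xS h_def X_def nS by (simp add: algebra_simps)
  have yS: "y (Suc k) = y k + b k * h k" for k
    by (simp add: y_def z xh)
  have XS: "X (Suc k) = (1 - om * g k) * X k - a * g k * y k + n (Suc k) * b k * h k" for k
    using xh[of k] yS[of k] by (simp add: X_def[of "Suc k"]) (simp add: h_def algebra_simps)
  have glim: "g \<longlonglongrightarrow> 0" and gsum: "filterlim (\<lambda>n. \<Sum>k<n. g k) at_top sequentially"
    using steps by auto
  have nlim: "n \<longlonglongrightarrow> 0"
    using pos(1) less_imp_le[OF g0] gsum glim noise nS unfolding a_def
    by (rule filtered_noise_tendsto_0)
  have "y \<longlonglongrightarrow> 0"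
    using steps
  proof (elim disjE conjE)
    assume "g = b"
    with XS yS show ?thesis
      by (intro one_timescale_tendsto_0[OF pos(1) a c g0 gsum glim nlim h_def]) auto
  next
    assume "filterlim (\<lambda>n. \<Sum>k<n. b k) at_top sequentially" "b \<longlonglongrightarrow> 0" "(\<lambda>k. b k / g k) \<longlonglongrightarrow> 0"
    then show ?thesis
      using two_timescale_tendsto_0[OF pos(1) a c b0 g0 _ _ glim nlim _ h_def XS yS] by blast
  qed
  then have "(\<lambda>k. y k + Delta) \<longlonglongrightarrow> 0 + Delta"
    by (intro tendsto_add tendsto_const)
  then show ?thesis by (simp add: y_def)
qed

subsection \<open>Kolmogorov's inequality and the convergence of random series\<close>

text \<open>Freezing the partial sums once they leave \<open>(-l, l)\<close> turns the maximum of their absolute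
  values over all times into the absolute value at the final time.\<close>
fun stopped_sum :: "real \<Rightarrow> (nat \<Rightarrow> real) \<Rightarrow> nat \<Rightarrow> real" where
  "stopped_sum l d 0 = 0"
| "stopped_sum l d (Suc n) = stopped_sum l d n + (if \<bar>stopped_sum l d n\<bar> < l then d n else 0)"

lemma stopped_sum_cong:
  "(\<And>i. i < n \<Longrightarrow> d i = d' i) \<Longrightarrow> stopped_sum l d n = stopped_sum l d' n"
  by (induction n) auto

text \<open>Until freezing the two sums agree, and a frozen value never changes afterwards.\<close>

lemma stopped_sum_hit:
  assumes "j \<le> n" "l \<le> \<bar>\<Sum>i<j. d i\<bar>"
  shows "l \<le> \<bar>stopped_sum l d n\<bar>"
proof -
  have stay: "l \<le> \<bar>stopped_sum l d m\<bar> \<Longrightarrow> l \<le> \<bar>stopped_sum l d (m + k)\<bar>" for m k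
    by (induction k) auto
  have "stopped_sum l d j = (\<Sum>i<j. d i) \<or> l \<le> \<bar>stopped_sum l d j\<bar>"
    by (induction j) auto
  then have "l \<le> \<bar>stopped_sum l d j\<bar>" using assms(2) by auto
  from stay[OF this, of "n - j"] assms(1) show ?thesis by simp
qed

lemma abs_stopped_sum_le:
  assumes "\<And>i. \<bar>d i\<bar> \<le> B i"
  shows "\<bar>stopped_sum l d n\<bar> \<le> (\<Sum>i<n. B i)"
proof (induction n)
  case (Suc n)
  then show ?case using assms[of n] by auto
qed simp

lemma measurable_stopped_sum [measurable]:
  assumes "\<And>i. i < n \<Longrightarrow> (\<lambda>w. f w i) \<in> borel_measurable N"
  shows "(\<lambda>w. stopped_sum l (f w) n) \<in> borel_measurable N"
  using assms
proof (induction n)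
  case (Suc n)
  have [measurable]: "(\<lambda>w. f w n) \<in> borel_measurable N" "(\<lambda>w. stopped_sum l (f w) n) \<in> borel_measurable N"
    using Suc by auto
  show ?case by simp
qed simp

text \<open>Whether the sum is frozen before step \<open>n\<close> depends only on the earlier
  variables. The cross term therefore vanishes by independence and zero mean, and each step adds at
  most \<open>(B n)^2\<close>.\<close>

lemma (in prob_space) stopped_sum_second_moment:
  fixes D :: "nat \<Rightarrow> 'a \<Rightarrow> real"
  assumes indep: "indep_vars (\<lambda>_. borel) D UNIV"
    and bound: "\<And>i w. \<bar>D i w\<bar> \<le> B i"
    and mean: "\<And>i. expectation (D i) = 0"
  shows "expectation (\<lambda>w. (stopped_sum l (\<lambda>i. D i w) n)\<^sup>2) \<le> (\<Sum>i<n. (B i)\<^sup>2)"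
proof (induction n)
  case 0
  show ?case by simp
next
  case (Suc n)
  let ?T = "\<lambda>n w. stopped_sum l (\<lambda>i. D i w) n"
  \<comment> \<open>Zero once frozen, so \<open>2 * ?H w * D n w\<close> is exactly the cross term
    of the squared step.\<close>
  let ?H = "\<lambda>w. if \<bar>?T n w\<bar> < l then ?T n w else 0"
  have [measurable]: "D i \<in> borel_measurable M" for i
    using indep by (auto simp: indep_vars_def)
  have B0: "0 \<le> B i" for i using bound[of i] abs_ge_zero order.trans by blast
  have Tb: "\<bar>?T m w\<bar> \<le> (\<Sum>i<m. B i)" for m w
    using bound by (rule abs_stopped_sum_le)
  have int_D: "integrable M (D i)" for i
    by (rule integrable_const_bound[where B = "B i"]) (use bound in auto)
  have int_H: "integrable M ?H"
    by (rule integrable_const_bound[where B = "\<Sum>i<n. B i"])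
       (use Tb[of _ n] B0 in \<open>auto intro: sum_nonneg\<close>)
  have int_HD: "integrable M (\<lambda>w. ?H w * D n w)"
    by (rule integrable_const_bound[where B = "(\<Sum>i<n. B i) * B n"])
       (use Tb[of _ n] B0 bound in \<open>auto simp: abs_mult intro!: mult_mono mult_nonneg_nonneg sum_nonneg\<close>)
  have int_T2: "integrable M (\<lambda>w. (?T n w)\<^sup>2)"
    by (rule integrable_const_bound[where B = "(\<Sum>i<n. B i)\<^sup>2"])
       (use Tb[of _ n] in \<open>auto simp: abs_le_square_iff[symmetric] intro: order.trans[OF _ abs_ge_self]\<close>)
  have "indep_var borel ?H borel (D n)"
  proof -
    let ?F = "\<lambda>f :: nat \<Rightarrow> real. if \<bar>stopped_sum l f n\<bar> < l then stopped_sum l f n else 0"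
    have "indep_var (PiM {..<n} (\<lambda>_. borel)) (\<lambda>w. restrict (\<lambda>i. D i w) {..<n})
        (PiM {n} (\<lambda>_. borel)) (\<lambda>w. restrict (\<lambda>i. D i w) {n})"
      by (rule indep_var_restrict[OF indep]) auto
    then have "indep_var borel (?F \<circ> (\<lambda>w. restrict (\<lambda>i. D i w) {..<n}))
        borel ((\<lambda>f :: nat \<Rightarrow> real. f n) \<circ> (\<lambda>w. restrict (\<lambda>i. D i w) {n}))"
      by (rule indep_var_compose) measurable
    moreover have "stopped_sum l (restrict (\<lambda>i. D i w) {..<n}) n = ?T n w" for w
      by (rule stopped_sum_cong) simp
    ultimately show ?thesis by (simp add: comp_def cong: if_cong)
  qed
  from indep_var_lebesgue_integral[OF this int_H int_D]
  have HD: "expectation (\<lambda>w. ?H w * D n w) = 0" using mean by simp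
  have "expectation (\<lambda>w. (?T (Suc n) w)\<^sup>2) \<le> expectation (\<lambda>w. (?T n w)\<^sup>2 + 2 * (?H w * D n w) + (B n)\<^sup>2)"
  proof (rule integral_mono)
    show "integrable M (\<lambda>w. (?T (Suc n) w)\<^sup>2)"
      by (rule integrable_const_bound[where B = "(\<Sum>i<Suc n. B i)\<^sup>2"])
         (use Tb[of _ "Suc n"] in \<open>auto simp del: stopped_sum.simps sum.lessThan_Suc
            simp: abs_le_square_iff[symmetric] intro: order.trans[OF _ abs_ge_self]\<close>)
    show "integrable M (\<lambda>w. (?T n w)\<^sup>2 + 2 * (?H w * D n w) + (B n)\<^sup>2)"
      using int_T2 int_HD by auto
    fix w
    have "(D n w)\<^sup>2 \<le> (B n)\<^sup>2" using bound[of n w] B0[of n] by (simp add: abs_le_square_iff[symmetric])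
    then show "(?T (Suc n) w)\<^sup>2 \<le> (?T n w)\<^sup>2 + 2 * (?H w * D n w) + (B n)\<^sup>2"
      by (auto simp: power2_sum)
  qed
  also have "\<dots> = expectation (\<lambda>w. (?T n w)\<^sup>2) + (B n)\<^sup>2"
    using int_T2 int_HD HD by (simp add: prob_space)
  finally show ?case using Suc.IH by simp
qed

text \<open>A path whose partial sums ever reach \<open>l\<close> in absolute value ends with a
  frozen sum at least that large, so Markov's inequality for the squared frozen sum
  suffices.\<close>

lemma (in prob_space) Kolmogorov_maximal_inequality:
  fixes D :: "nat \<Rightarrow> 'a \<Rightarrow> real"
  assumes indep: "indep_vars (\<lambda>_. borel) D UNIV"
    and bound: "\<And>i w. \<bar>D i w\<bar> \<le> B i"
    and mean: "\<And>i. expectation (D i) = 0"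
    and l: "l > 0"
  shows "prob {w \<in> space M. \<exists>j\<le>n. l \<le> \<bar>\<Sum>i<j. D i w\<bar>} \<le> (\<Sum>i<n. (B i)\<^sup>2) / l\<^sup>2"
proof -
  let ?T = "\<lambda>w. stopped_sum l (\<lambda>i. D i w) n"
  have [measurable]: "D i \<in> borel_measurable M" for i
    using indep by (auto simp: indep_vars_def)
  have Tb: "\<bar>?T w\<bar> \<le> (\<Sum>i<n. B i)" for w
    using bound by (rule abs_stopped_sum_le)
  have int: "integrable M (\<lambda>w. (?T w)\<^sup>2)"
    by (rule integrable_const_bound[where B = "(\<Sum>i<n. B i)\<^sup>2"])
       (use Tb in \<open>auto simp: abs_le_square_iff[symmetric] intro: order.trans[OF _ abs_ge_self]\<close>)
  have "prob {w \<in> space M. \<exists>j\<le>n. l \<le> \<bar>\<Sum>i<j. D i w\<bar>} \<le> prob {w \<in> space M. l\<^sup>2 \<le> (?T w)\<^sup>2}"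
  proof (rule finite_measure_mono)
    show "{w \<in> space M. \<exists>j\<le>n. l \<le> \<bar>\<Sum>i<j. D i w\<bar>} \<subseteq> {w \<in> space M. l\<^sup>2 \<le> (?T w)\<^sup>2}"
      using l by (auto simp: abs_le_square_iff[symmetric] dest!: stopped_sum_hit)
  qed measurable
  also have "\<dots> \<le> expectation (\<lambda>w. (?T w)\<^sup>2) / l\<^sup>2"
    using integral_Markov_inequality_measure[OF int, of "{}" "l\<^sup>2"] l by simp
  also have "\<dots> \<le> (\<Sum>i<n. (B i)\<^sup>2) / l\<^sup>2"
    using stopped_sum_second_moment[OF indep bound mean] l by (intro divide_right_mono) auto
  finally show ?thesis .
qed

text \<open>The maximal inequality for the tail starting at \<open>m\<close> bounds the probability
  of an oscillation of size \<open>l\<close> by a tail of the series of \<open>(B i)^2\<close>.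
  Letting \<open>m\<close> grow makes the partial sums almost surely Cauchy.\<close>

lemma (in prob_space) Kolmogorov_convergence:
  fixes D :: "nat \<Rightarrow> 'a \<Rightarrow> real"
  assumes indep: "indep_vars (\<lambda>_. borel) D UNIV"
    and bound: "\<And>i w. \<bar>D i w\<bar> \<le> B i"
    and mean: "\<And>i. expectation (D i) = 0"
    and B: "summable (\<lambda>i. (B i)\<^sup>2)"
  shows "AE w in M. summable (\<lambda>i. D i w)"
proof -
  have [measurable]: "D i \<in> borel_measurable M" for i
    using indep by (auto simp: indep_vars_def)
  have tail: "prob {w \<in> space M. \<exists>j. l \<le> \<bar>\<Sum>i<j. D (m + i) w\<bar>} \<le> (\<Sum>i. (B (m + i))\<^sup>2) / l\<^sup>2"
    if l: "l > 0" for l m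
  proof -
    have ind: "indep_vars (\<lambda>_. borel) (\<lambda>i. D (m + i)) UNIV"
    proof -
      \<comment> \<open>Grouping into the disjoint singleton blocks \<open>{m + i}\<close> performs
        the reindexing.\<close>
      have "indep_vars (\<lambda>i. PiM {m + i} (\<lambda>_. borel)) (\<lambda>i w. restrict (\<lambda>k. D k w) {m + i}) UNIV"
        by (rule indep_vars_restrict[OF indep]) (auto simp: disjoint_family_on_def)
      then have "indep_vars (\<lambda>_. borel) (\<lambda>i w. (\<lambda>f. f (m + i)) (restrict (\<lambda>k. D k w) {m + i})) UNIV"
        by (rule indep_vars_compose2) simp
      then show ?thesis by simp
    qed
    have sm: "summable (\<lambda>i. (B (m + i))\<^sup>2)"
      using summable_ignore_initial_segment[OF B, of m] by (simp add: add.commute)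
    let ?E = "\<lambda>n. {w \<in> space M. \<exists>j\<le>n. l \<le> \<bar>\<Sum>i<j. D (m + i) w\<bar>}"
    have "(\<lambda>n. prob (?E n)) \<longlonglongrightarrow> prob (\<Union>n. ?E n)"
      by (rule finite_Lim_measure_incseq) (auto intro!: incseq_SucI intro: le_SucI)
    moreover have "prob (?E n) \<le> (\<Sum>i. (B (m + i))\<^sup>2) / l\<^sup>2" for n
    proof -
      have "prob (?E n) \<le> (\<Sum>i<n. (B (m + i))\<^sup>2) / l\<^sup>2"
        using Kolmogorov_maximal_inequality[OF ind bound mean l] .
      also have "\<dots> \<le> (\<Sum>i. (B (m + i))\<^sup>2) / l\<^sup>2"
        using sum_le_suminf[OF sm, of "{..<n}"] by (intro divide_right_mono) auto
      finally show ?thesis .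
    qed
    ultimately have "prob (\<Union>n. ?E n) \<le> (\<Sum>i. (B (m + i))\<^sup>2) / l\<^sup>2"
      by (intro LIMSEQ_le_const2) auto
    moreover have "(\<Union>n. ?E n) = {w \<in> space M. \<exists>j. l \<le> \<bar>\<Sum>i<j. D (m + i) w\<bar>}" by auto
    ultimately show ?thesis by simp
  qed
  have osc: "AE w in M. \<exists>m. \<forall>j. \<bar>\<Sum>i<j. D (m + i) w\<bar> < l" if l: "l > 0" for l
  proof -
    let ?A = "{w \<in> space M. \<forall>m. \<exists>j. l \<le> \<bar>\<Sum>i<j. D (m + i) w\<bar>}"
    have "(\<lambda>m. (\<Sum>i. (B (m + i))\<^sup>2) / l\<^sup>2) \<longlonglongrightarrow> 0 / l\<^sup>2"
      using suminf_exist_split2[OF B] by (intro tendsto_divide) (use l in \<open>auto simp: add.commute\<close>)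
    moreover have "prob ?A \<le> (\<Sum>i. (B (m + i))\<^sup>2) / l\<^sup>2" for m
      by (rule order.trans[OF finite_measure_mono tail[OF l, of m]]) auto
    ultimately have "prob ?A \<le> 0"
      by (intro LIMSEQ_le_const) auto
    then have "prob ?A = 0" by (simp add: measure_le_0_iff)
    then have "AE w in M. \<not> (\<forall>m. \<exists>j. l \<le> \<bar>\<Sum>i<j. D (m + i) w\<bar>)"
      by (intro AE_I[where N = ?A]) (auto simp: emeasure_eq_measure)
    then show ?thesis by eventually_elim (auto simp: not_le)
  qed
  have "AE w in M. \<forall>r. \<exists>m. \<forall>j. \<bar>\<Sum>i<j. D (m + i) w\<bar> < inverse (real (Suc r))"
    unfolding AE_all_countable by (intro allI osc) simp
  then show ?thesis
  proof eventually_elim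
    case (elim w)
    have part: "\<bar>\<Sum>i\<in>{m..<n}. D i w\<bar> = \<bar>\<Sum>i<n - m. D (m + i) w\<bar>" if "m \<le> n" for m n
      using that sum.shift_bounds_nat_ivl[of "\<lambda>i. D i w" 0 m "n - m"]
      by (simp add: add.commute atLeast0LessThan)
    have "Cauchy (\<lambda>n. \<Sum>i<n. D i w)"
    proof (rule metric_CauchyI)
      fix e :: real assume "e > 0"
      then obtain r where r: "inverse (real (Suc r)) < e / 2"
        using reals_Archimedean[of "e / 2"] by auto
      obtain m where m: "\<And>j. \<bar>\<Sum>i<j. D (m + i) w\<bar> < inverse (real (Suc r))"
        using elim by blast
      have "dist (\<Sum>i<n. D i w) (\<Sum>i<m. D i w) < e / 2" if "n \<ge> m" for n
      proof -
        have "(\<Sum>i<n. D i w) - (\<Sum>i<m. D i w) = (\<Sum>i\<in>{m..<n}. D i w)"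
          using that sum_diff_nat_ivl[of 0 m n "\<lambda>i. D i w"] by (simp add: atLeast0LessThan)
        then show ?thesis using part[OF that] m[of "n - m"] r by (simp add: dist_real_def)
      qed
      then have "dist (\<Sum>i<n. D i w) (\<Sum>i<n'. D i w) < e" if "n \<ge> m" "n' \<ge> m" for n n'
        using that dist_triangle_half_l by blast
      then show "\<exists>M. \<forall>n\<ge>M. \<forall>n'\<ge>M. dist (\<Sum>i<n. D i w) (\<Sum>i<n'. D i w) < e" by blast
    qed
    then show ?case by (simp add: summable_iff_convergent Cauchy_convergent_iff)
  qed
qed

subsection \<open>Independence of the change indicators\<close>

text \<open>An indicator has at most four preimages, all in the sigma-algebra generated by
  \<open>A i\<close>. Independence passes to these sigma-algebras because a single set is stable
  under intersection.\<close>

lemma (in prob_space) indep_vars_indicator: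
  assumes "indep_events A I"
  shows "indep_vars (\<lambda>_. borel) (\<lambda>i. indicator (A i) :: 'a \<Rightarrow> real) I"
  unfolding indep_vars_def2
proof
  have A: "A i \<in> events" if "i \<in> I" for i
    using assms that by (auto simp: indep_events_def)
  then show "\<forall>i\<in>I. random_variable borel (indicator (A i) :: 'a \<Rightarrow> real)" by auto
  have "indep_sets (\<lambda>i. sigma_sets (space M) {A i}) I"
    using assms by (intro indep_sets_sigma) (auto simp: indep_events_def_alt Int_stable_def)
  then show "indep_sets (\<lambda>i. {(indicator (A i) :: 'a \<Rightarrow> real) -` B \<inter> space M |B. B \<in> sets borel}) I"
  proof (rule indep_sets_mono_sets)
    fix i assume i: "i \<in> I"
    show "{(indicator (A i) :: 'a \<Rightarrow> real) -` B \<inter> space M |B. B \<in> sets borel} \<subseteq> sigma_sets (space M) {A i}"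
    proof safe
      fix B :: "real set"
      have sub: "A i \<subseteq> space M" using A[OF i] sets.sets_into_space by blast
      then have "(indicator (A i) :: 'a \<Rightarrow> real) -` B \<inter> space M =
          (if 1 \<in> B then (if 0 \<in> B then space M else A i) else (if 0 \<in> B then space M - A i else {}))"
        by (auto simp: indicator_def of_bool_def split: if_splits)
      then show "(indicator (A i) :: 'a \<Rightarrow> real) -` B \<inter> space M \<in> sigma_sets (space M) {A i}"
        by (auto intro: sigma_sets.intros sigma_sets_top)
    qed
  qed
qed

section \<open>Exponential waiting times\<close>

text \<open>By Fubini the tail \<open>exp (- l * q)\<close> of \<open>X\<close> is integrated over
  the law of \<open>Q\<close>. Negative values of \<open>Q\<close> are left out so that they can
  mark discarded outcomes.\<close>

lemma (in prob_space) exponential_tail_indep: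
  assumes X: "distributed M lborel X (exponential_density l)" and l: "l > 0"
    and indep: "indep_var borel Q borel X"
  shows "prob {w \<in> space M. 0 \<le> Q w \<and> Q w < X w} = expectation (\<lambda>w. if 0 \<le> Q w then exp (- l * Q w) else 0)"
proof -
  have [measurable]: "random_variable borel Q" "random_variable borel X"
    using indep by (auto dest: indep_var_rv1 indep_var_rv2)
  interpret DX: prob_space "distr M borel X" by (rule prob_space_distr) simp
  let ?S = "{x :: real \<times> real. 0 \<le> fst x \<and> fst x < snd x}"
  have "{x \<in> space (borel \<Otimes>\<^sub>M borel). (0 :: real) \<le> fst x \<and> fst x < snd x} \<in> sets (borel \<Otimes>\<^sub>M borel)"
    by measurable
  then have S: "?S \<in> sets (borel \<Otimes>\<^sub>M borel)" by (simp add: space_pair_measure)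
  have "emeasure M {w \<in> space M. 0 \<le> Q w \<and> Q w < X w}
      = emeasure (distr M (borel \<Otimes>\<^sub>M borel) (\<lambda>w. (Q w, X w))) ?S"
    using S by (subst emeasure_distr) (auto intro!: arg_cong[where f = "emeasure M"])
  also have "\<dots> = emeasure (distr M borel Q \<Otimes>\<^sub>M distr M borel X) ?S"
    using indep unfolding indep_var_distribution_eq by simp
  also have "\<dots> = (\<integral>\<^sup>+ q. emeasure (distr M borel X) (Pair q -` ?S) \<partial>distr M borel Q)"
    using S by (intro DX.emeasure_pair_measure_alt) (simp cong: sets_pair_measure_cong)
  also have "\<dots> = (\<integral>\<^sup>+ q. ennreal (if 0 \<le> q then exp (- l * q) else 0) \<partial>distr M borel Q)"
  proof (rule nn_integral_cong)
    fix q :: real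
    show "emeasure (distr M borel X) (Pair q -` ?S) = ennreal (if 0 \<le> q then exp (- l * q) else 0)"
    proof (cases "0 \<le> q")
      case True
      then have "Pair q -` ?S = {q<..}" by auto
      then have "emeasure (distr M borel X) (Pair q -` ?S) = emeasure M {w \<in> space M. q < X w}"
        by (subst emeasure_distr) (auto intro!: arg_cong[where f = "emeasure M"])
      also have "\<dots> = ennreal (exp (- l * q))"
        using exponential_distributedD_gt[OF X True l] by (simp add: emeasure_eq_measure mult.commute)
      finally show ?thesis using True by simp
    qed simp
  qed
  also have "\<dots> = (\<integral>\<^sup>+ w. ennreal (if 0 \<le> Q w then exp (- l * Q w) else 0) \<partial>M)"
    by (rule nn_integral_distr) measurable
  also have "\<dots> = ennreal (expectation (\<lambda>w. if 0 \<le> Q w then exp (- l * Q w) else 0))"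
    using l by (intro nn_integral_eq_integral integrable_const_bound[where B = 1]) auto
  finally show ?thesis
    by (simp add: emeasure_eq_measure)
qed

text \<open>\<open>exp (- l * x)\<close> times the density of rate \<open>p\<close> is
  \<open>p / (l + p)\<close> times the density of rate \<open>l + p\<close>.\<close>

lemma (in prob_space) exponential_laplace_transform:
  assumes Y: "distributed M lborel Y (exponential_density p)" and p: "p > 0" and l: "l > 0"
  shows "expectation (\<lambda>w. exp (- l * Y w)) = p / (l + p)"
proof -
  interpret E: prob_space "density lborel (exponential_density (l + p))"
    using p l by (intro prob_space_exponential_density) simp
  have one: "(\<integral>\<^sup>+x. ennreal (exponential_density (l + p) x) \<partial>lborel) = 1"
    using E.emeasure_space_1 by (simp add: emeasure_density)
  have [measurable]: "Y \<in> borel_measurable M" using distributed_measurable[OF Y] by simp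
  have "(\<integral>\<^sup>+w. ennreal (exp (- l * Y w)) \<partial>M)
      = (\<integral>\<^sup>+x. ennreal (exponential_density p x) * ennreal (exp (- l * x)) \<partial>lborel)"
    by (rule distributed_nn_integral[OF Y, symmetric]) simp
  also have "\<dots> = (\<integral>\<^sup>+x. ennreal (p / (l + p)) * ennreal (exponential_density (l + p) x) \<partial>lborel)"
    using p l by (intro nn_integral_cong)
      (auto simp: exponential_density_def ennreal_mult'[symmetric] exp_add[symmetric] field_simps)
  also have "\<dots> = ennreal (p / (l + p))"
    by (simp add: nn_integral_cmult one)
  finally have "(\<integral>\<^sup>+w. ennreal (exp (- l * Y w)) \<partial>M) = ennreal (p / (l + p))" .
  then show ?thesis
    using p l by (intro integral_eq_nn_integral[THEN trans]) auto
qed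

section \<open>Interlacing of change times \<open>c\<close> and access times
  \<open>t\<close>\<close>

text \<open>Changes after the first \<open>n\<close> come later than \<open>t k\<close>, hence after
  every interval indexed by \<open>S\<close>. So the first \<open>n\<close> changes decide whether
  these intervals are free of changes.\<close>

lemma interval_counting:
  fixes c t :: "nat \<Rightarrow> real"
  assumes c: "strict_mono c" and t: "mono t"
    and n: "c n \<le> t k" "t k < c (Suc n)" and S: "S \<subseteq> {..<k}"
    and past: "\<forall>i\<in>S. \<forall>m<n. \<not> (t i < c (Suc m) \<and> c (Suc m) \<le> t (Suc i))"
    and i: "i \<in> S"
  shows "\<not> (\<exists>m. t i < c (Suc m) \<and> c (Suc m) \<le> t (Suc i))"
proof clarify
  fix m assume m: "t i < c (Suc m)" "c (Suc m) \<le> t (Suc i)"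
  show False
  proof (cases "m < n")
    case True
    then show ?thesis using past i m by blast
  next
    case False
    then have "c (Suc n) \<le> c (Suc m)" using c by (simp add: strict_mono_less_eq)
    moreover have "t (Suc i) \<le> t k" using i S by (intro monoD[OF t]) auto
    ultimately show ?thesis using n m by linarith
  qed
qed

text \<open>\<open>c (Suc n)\<close> is the first change after \<open>t k\<close>, so any change in
  the interval forces this one to lie there too.\<close>

lemma last_interval_empty_iff:
  fixes c t :: "nat \<Rightarrow> real"
  assumes c: "strict_mono c" and n: "c n \<le> t k" "t k < c (Suc n)"
  shows "(\<exists>m. t k < c (Suc m) \<and> c (Suc m) \<le> t (Suc k)) \<longleftrightarrow> c (Suc n) \<le> t (Suc k)"
proof
  assume "\<exists>m. t k < c (Suc m) \<and> c (Suc m) \<le> t (Suc k)"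
  then obtain m where m: "t k < c (Suc m)" "c (Suc m) \<le> t (Suc k)" by blast
  have "n \<le> m"
  proof (rule ccontr)
    assume "\<not> n \<le> m"
    then have "c (Suc m) \<le> c n" using c by (simp add: strict_mono_less_eq)
    then show False using n m by linarith
  qed
  then have "c (Suc n) \<le> c (Suc m)" using c by (simp add: strict_mono_less_eq)
  then show "c (Suc n) \<le> t (Suc k)" using m by linarith
qed (use n in blast)

lemma bracketing_index_unique:
  fixes c :: "nat \<Rightarrow> real"
  assumes c: "strict_mono c" and "c m \<le> s" "s < c (Suc m)" "c n \<le> s" "s < c (Suc n)"
  shows "m = n"
proof -
  have "c m < c (Suc n)" "c n < c (Suc m)" using assms by linarith+
  then show ?thesis using c by (simp add: strict_mono_less)
qed

lemma bracketing_index_exists: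
  fixes c :: "nat \<Rightarrow> real"
  assumes "c 0 \<le> s" "\<exists>n. s < c n"
  shows "\<exists>n. c n \<le> s \<and> s < c (Suc n)"
proof -
  define N where "N = (LEAST n. s < c n)"
  have N: "s < c N" unfolding N_def using assms(2) by (rule LeastI_ex)
  then have "N \<noteq> 0" using assms(1) by (intro notI) simp
  then obtain n where n: "N = Suc n" by (cases N) auto
  have "\<not> s < c n" using not_less_Least[of n "\<lambda>n. s < c n"] n by (simp add: N_def)
  then show ?thesis using N n by (intro exI[of _ n]) auto
qed

text \<open>\<open>unchanged X Y k\<close> refers to the interval of \<open>change_ind X Y (Suc k)\<close>, and
  \<open>change_time X m\<close> is written as \<open>access_time X (Suc m)\<close>, so that the partial sums start at \<open>0\<close>.\<close>
definition unchanged :: "(nat \<Rightarrow> 'a \<Rightarrow> real) \<Rightarrow> (nat \<Rightarrow> 'a \<Rightarrow> real) \<Rightarrow> nat \<Rightarrow> 'a \<Rightarrow> bool" where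
  "unchanged X Y k w \<longleftrightarrow>
     \<not> (\<exists>m. access_time Y k w < access_time X (Suc m) w \<and> access_time X (Suc m) w \<le> access_time Y (Suc k) w)"

lemma change_ind_eq_unchanged: "change_ind X Y (Suc k) w = 1 - of_bool (unchanged X Y k w)"
  by (auto simp: change_ind_def unchanged_def change_time_def access_time_def lessThan_Suc_atMost)

section \<open>The joint process and its memorylessness\<close>

text \<open>A single independent family over \<open>nat + nat\<close> also makes the two processes
  independent of each other, and any block of past waiting times can be split off by
  \<open>restrict\<close>.\<close>

locale page_process = prob_space M for M :: "'a measure" +
  fixes X Y :: "nat \<Rightarrow> 'a \<Rightarrow> real" and Delta p :: real
  assumes Delta_pos: "Delta > 0" and p_pos: "p > 0"
    and indep: "indep_vars (\<lambda>_. borel) (\<lambda>i. case_sum X Y i) UNIV"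
    and X_exp: "\<And>n. distributed M lborel (X n) (\<lambda>x. ennreal (exponential_density Delta x))"
    and Y_exp: "\<And>n. distributed M lborel (Y n) (\<lambda>x. ennreal (exponential_density p x))"
begin

lemma X_measurable [measurable]: "X n \<in> borel_measurable M"
  using distributed_measurable[OF X_exp] by simp

lemma Y_measurable [measurable]: "Y n \<in> borel_measurable M"
  using distributed_measurable[OF Y_exp] by simp

lemma access_time_measurable [measurable]:
  "access_time X n \<in> borel_measurable M" "access_time Y n \<in> borel_measurable M"
  unfolding access_time_def[abs_def] by measurable

lemma unchanged_measurable [measurable]: "Measurable.pred M (unchanged X Y k)"
  unfolding unchanged_def[abs_def] by measurable

lemma AE_positive: "AE w in M. (\<forall>n. X n w > 0) \<and> (\<forall>n. Y n w > 0)"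
proof -
  have "AE w in M. X n w > 0" "AE w in M. Y n w > 0" for n
    using exponential_distributedD_gt[OF X_exp order.refl Delta_pos, of n]
      exponential_distributedD_gt[OF Y_exp order.refl p_pos, of n]
    by (auto simp: prob_Collect_eq_1)
  then show ?thesis by (simp add: AE_all_countable)
qed

text \<open>The first \<open>n + 1\<close> waiting times all stay below \<open>b\<close> with
  probability \<open>?q ^ Suc n\<close>, which tends to 0. This is what sends the change times to
  infinity.\<close>

lemma AE_unbounded: "AE w in M. \<forall>b::nat. \<exists>n. real b < X n w"
  unfolding AE_all_countable
proof
  fix b :: nat
  let ?q = "1 - exp (- real b * Delta)"
  let ?A = "{w \<in> space M. \<forall>n. X n w \<le> real b}"
  have "prob ?A \<le> ?q ^ Suc n" for n
  proof -
    let ?Z = "\<lambda>i. case_sum X Y i -` {..real b} \<inter> space M"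
    have "prob ?A \<le> prob (\<Inter>i\<in>Inl ` {..n}. ?Z i)"
      by (rule finite_measure_mono) auto
    also have "\<dots> = (\<Prod>i\<in>Inl ` {..n}. prob (?Z i))"
      by (rule indep_varsD[OF indep]) auto
    also have "\<dots> = (\<Prod>i\<le>n. prob (X i -` {..real b} \<inter> space M))"
      by (subst prod.reindex) auto
    also have "X i -` {..real b} \<inter> space M = {w \<in> space M. X i w \<le> real b}" for i by auto
    then have "(\<Prod>i\<le>n. prob (X i -` {..real b} \<inter> space M)) = ?q ^ Suc n"
      using exponential_distributedD_le[OF X_exp _ Delta_pos, of "real b"] by simp
    finally show ?thesis .
  qed
  moreover have "(\<lambda>n. ?q ^ Suc n) \<longlonglongrightarrow> 0"
    using Delta_pos by (intro LIMSEQ_Suc[OF LIMSEQ_power_zero]) (auto simp: mult_nonneg_nonneg)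
  ultimately have "prob ?A \<le> 0"
    by (intro LIMSEQ_le_const) auto
  then have "prob ?A = 0" by (simp add: measure_le_0_iff)
  then have "AE w in M. \<not> (\<forall>n. X n w \<le> real b)"
    by (intro AE_I[where N = ?A]) (auto simp: emeasure_eq_measure)
  then show "AE w in M. \<exists>n. real b < X n w"
    by eventually_elim (auto simp: not_le)
qed

lemma AE_regular:
  "AE w in M. strict_mono (\<lambda>n. access_time X n w) \<and> strict_mono (\<lambda>n. access_time Y n w)
     \<and> (\<forall>s. \<exists>n. s < access_time X n w)"
  using AE_positive AE_unbounded
proof eventually_elim
  case (elim w)
  have "\<exists>n. s < access_time X n w" for s
  proof -
    obtain b :: nat where b: "s \<le> real b" using real_arch_simple by blast
    obtain n where n: "real b < X n w" using elim by blast
    have "0 \<le> (\<Sum>i<n. X i w)"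
      by (intro sum_nonneg less_imp_le) (use elim in auto)
    then have "X n w \<le> access_time X (Suc n) w" by (simp add: access_time_def)
    then show ?thesis using b n by (intro exI[of _ "Suc n"]) linarith
  qed
  then show ?case using elim by (auto simp: strict_mono_Suc_iff access_time_def)
qed

text \<open>\<open>R\<close> depends on neither \<open>X n\<close> nor \<open>Y k\<close>. Both
  probabilities are thus expectations of \<open>exp (- Delta * _)\<close> over nonnegative
  thresholds, and the extra summand \<open>Y k\<close> contributes its Laplace transform as an
  independent factor.\<close>

lemma memoryless_step:
  fixes F :: "(nat + nat \<Rightarrow> real) \<Rightarrow> real"
  assumes F: "F \<in> borel_measurable (PiM A (\<lambda>_. borel))"
    and A: "Inl n \<notin> A" "Inr k \<notin> A"
  defines "R \<equiv> \<lambda>w. F (restrict (\<lambda>i. case_sum X Y i w) A)"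
  shows "prob {w \<in> space M. 0 \<le> R w \<and> R w + Y k w < X n w}
       = p / (Delta + p) * prob {w \<in> space M. 0 \<le> R w \<and> R w < X n w}"
proof -
  let ?Z = "\<lambda>B w. restrict (\<lambda>i. case_sum X Y i w) B"
  let ?P = "\<lambda>B. PiM B (\<lambda>_ :: nat + nat. borel :: real measure)"
  \<comment> \<open>\<open>max 0\<close> keeps \<open>Q\<close> nonnegative exactly where
    \<open>R\<close> is, at every point; almost surely it does not alter \<open>Y k\<close>.\<close>
  define Q where "Q w = (if 0 \<le> R w then R w + max 0 (Y k w) else - 1)" for w
  have comp: "indep_var borel (\<lambda>w. G (?Z B w)) borel (\<lambda>w. H (?Z C w))"
    if "G \<in> borel_measurable (?P B)" "H \<in> borel_measurable (?P C)" "B \<inter> C = {}"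
    for G H :: "(nat + nat \<Rightarrow> real) \<Rightarrow> real" and B C
    using indep_var_compose[OF indep_var_restrict[OF indep that(3)] that(1,2)] by (simp add: comp_def)
  have RX: "indep_var borel R borel (X n)"
    using comp[OF F, of "\<lambda>f. f (Inl n)" "{Inl n}"] A by (simp add: R_def)
  have RY: "indep_var borel R borel (Y k)"
    using comp[OF F, of "\<lambda>f. f (Inr k)" "{Inr k}"] A by (simp add: R_def)
  have QX: "indep_var borel Q borel (X n)"
  proof -
    let ?B = "insert (Inr k) A"
    have [measurable]: "(\<lambda>f. F (restrict f A)) \<in> borel_measurable (?P ?B)"
      by (rule measurable_compose[OF measurable_restrict_subset F]) auto
    have [measurable]: "(\<lambda>f. f (Inr k)) \<in> borel_measurable (?P ?B)" by simp
    have "(\<lambda>f. if 0 \<le> F (restrict f A) then F (restrict f A) + max 0 (f (Inr k)) else - 1)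
        \<in> borel_measurable (?P ?B)" by measurable
    from comp[OF this, of "\<lambda>f. f (Inl n)" "{Inl n}"] show ?thesis
      using A by (simp add: Q_def[abs_def] R_def Int_absorb1 subset_insertI cong: if_cong)
  qed
  have [measurable]: "R \<in> borel_measurable M" "Q \<in> borel_measurable M"
    using RX QX by (auto dest: indep_var_rv1)
  let ?e = "\<lambda>w. if 0 \<le> R w then exp (- Delta * R w) else 0"
  have int1: "integrable M ?e"
    using Delta_pos by (intro integrable_const_bound[where B = 1]) auto
  have int2: "integrable M (\<lambda>w. exp (- Delta * Y k w))"
  proof (rule integrable_const_bound[where B = 1])
    show "AE w in M. norm (exp (- Delta * Y k w)) \<le> 1"
      using AE_positive by eventually_elim (use Delta_pos in \<open>simp add: less_imp_le\<close>)
  qed measurable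
  have "prob {w \<in> space M. 0 \<le> R w \<and> R w + Y k w < X n w} = prob {w \<in> space M. 0 \<le> Q w \<and> Q w < X n w}"
  proof (rule prob_eq_AE)
    show "AE w in M. (0 \<le> R w \<and> R w + Y k w < X n w) \<longleftrightarrow> (0 \<le> Q w \<and> Q w < X n w)"
      using AE_positive
    proof eventually_elim
      case (elim w)
      then have "max 0 (Y k w) = Y k w" "0 < Y k w" by (auto simp: max_def less_imp_le)
      then show ?case by (auto simp: Q_def)
    qed
  qed measurable
  also have "\<dots> = expectation (\<lambda>w. if 0 \<le> Q w then exp (- Delta * Q w) else 0)"
    using exponential_tail_indep[OF X_exp Delta_pos QX] .
  also have "\<dots> = expectation (\<lambda>w. ?e w * exp (- Delta * Y k w))"
  proof (rule integral_cong_AE)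
    show "AE w in M. (if 0 \<le> Q w then exp (- Delta * Q w) else 0) = ?e w * exp (- Delta * Y k w)"
      using AE_positive
    proof eventually_elim
      case (elim w)
      then have "max 0 (Y k w) = Y k w" "0 < Y k w" by (auto simp: max_def less_imp_le)
      then show ?case by (auto simp: Q_def exp_add[symmetric] algebra_simps)
    qed
  qed measurable
  also have "\<dots> = expectation ?e * expectation (\<lambda>w. exp (- Delta * Y k w))"
  proof (rule indep_var_lebesgue_integral[OF _ int1 int2])
    have "indep_var borel ((\<lambda>r. if 0 \<le> r then exp (- Delta * r) else 0) \<circ> R) borel ((\<lambda>y. exp (- Delta * y)) \<circ> Y k)"
      by (rule indep_var_compose[OF RY]) measurable
    then show "indep_var borel ?e borel (\<lambda>w. exp (- Delta * Y k w))"
      by (simp add: comp_def)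
  qed
  also have "expectation ?e = prob {w \<in> space M. 0 \<le> R w \<and> R w < X n w}"
    using exponential_tail_indep[OF X_exp Delta_pos RX] by simp
  also have "expectation (\<lambda>w. exp (- Delta * Y k w)) = p / (Delta + p)"
    by (rule exponential_laplace_transform[OF Y_exp p_pos Delta_pos])
  finally show ?thesis by simp
qed

text \<open>Split according to the number \<open>n\<close> of changes up to time \<open>t k\<close>: the remaining waiting time
  \<open>R\<close> that \<open>X n\<close> has to exceed is a function of the past, and \<open>R = -1\<close> encodes that the
  prescribed past did not occur.\<close>
lemma prob_unchanged_step:
  assumes S: "S \<subseteq> {..<k}"
  shows "prob {w \<in> space M. (\<forall>i\<in>S. unchanged X Y i w) \<and> unchanged X Y k w}
       = p / (Delta + p) * prob {w \<in> space M. \<forall>i\<in>S. unchanged X Y i w}"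
proof -
  let ?a = "p / (Delta + p)"
  let ?c = "\<lambda>n w. access_time X n w" and ?t = "\<lambda>n w. access_time Y n w"
  have a0: "0 \<le> ?a" using Delta_pos p_pos by simp
  have finS: "finite S" using S finite_subset by blast
  define past where "past n w \<longleftrightarrow> (\<forall>i\<in>S. \<forall>m<n. \<not> (?t i w < ?c (Suc m) w \<and> ?c (Suc m) w \<le> ?t (Suc i) w))
      \<and> ?c n w \<le> ?t k w" for n w
  have [measurable]: "Measurable.pred M (past n)" for n
    using finS unfolding past_def[abs_def] by measurable
  \<comment> \<open>\<open>U n\<close> says that exactly \<open>n\<close> changes precede or meet
    \<open>t k\<close> and the intervals of \<open>S\<close> are free of them; \<open>W n\<close>
    extends the wait for the next change beyond the interval numbered \<open>k\<close>.\<close>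
  define U where "U n w \<longleftrightarrow> past n w \<and> ?t k w < ?c (Suc n) w" for n w
  define W where "W n w \<longleftrightarrow> past n w \<and> ?t (Suc k) w < ?c (Suc n) w" for n w
  have [measurable]: "Measurable.pred M (U n)" "Measurable.pred M (W n)" for n
    unfolding U_def[abs_def] W_def[abs_def] by measurable
  have step: "prob {w \<in> space M. W n w} = ?a * prob {w \<in> space M. U n w}" for n
  proof -
    \<comment> \<open>Both sequences of times as functions of the coordinates. The block
      \<open>A\<close> suffices for the past because \<open>i\<close> in \<open>S\<close> gives
      \<open>Suc i <= k\<close>.\<close>
    define c' t' where "c' m f = (\<Sum>i<m. f (Inl i))" and "t' m f = (\<Sum>i<m. f (Inr i))"
      for m :: nat and f :: "nat + nat \<Rightarrow> real"
    define A :: "(nat + nat) set" where "A = Inl ` {..<n} \<union> Inr ` {..<k}"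
    define E where "E f \<longleftrightarrow> (\<forall>i\<in>S. \<forall>m\<in>{..<n}. \<not> (t' i f < c' (Suc m) f \<and> c' (Suc m) f \<le> t' (Suc i) f))" for f
    define F where "F f = (if E f \<and> c' n f \<le> t' k f then t' k f - c' n f else - 1)" for f
    have c'_meas: "c' m \<in> borel_measurable (PiM A (\<lambda>_. borel))" if "m \<le> n" for m
      unfolding c'_def[abs_def] using that
      by (intro borel_measurable_sum measurable_component_singleton) (auto simp: A_def)
    have t'_meas: "t' m \<in> borel_measurable (PiM A (\<lambda>_. borel))" if "m \<le> k" for m
      unfolding t'_def[abs_def] using that
      by (intro borel_measurable_sum measurable_component_singleton) (auto simp: A_def)
    have [measurable]: "Measurable.pred (PiM A (\<lambda>_. borel)) E"
      unfolding E_def[abs_def]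
    proof (intro pred_intros_finite finS finite_lessThan)
      fix i m assume "i \<in> S" "m \<in> {..<n}"
      then have "t' i \<in> borel_measurable (PiM A (\<lambda>_. borel))"
          "t' (Suc i) \<in> borel_measurable (PiM A (\<lambda>_. borel))"
          "c' (Suc m) \<in> borel_measurable (PiM A (\<lambda>_. borel))"
        using S by (auto intro!: t'_meas c'_meas)
      moreover have "Measurable.pred N (\<lambda>f. \<not> (u f < v f \<and> v f \<le> x f))"
        if "u \<in> borel_measurable N" "v \<in> borel_measurable N" "x \<in> borel_measurable N"
        for N :: "(nat + nat \<Rightarrow> real) measure" and u v x :: "(nat + nat \<Rightarrow> real) \<Rightarrow> real"
      proof -
        have [measurable]: "Measurable.pred N (\<lambda>f. u f < v f)" "Measurable.pred N (\<lambda>f. v f \<le> x f)"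
          unfolding pred_def using that by (auto intro: borel_measurable_less borel_measurable_le)
        show ?thesis by measurable
      qed
      ultimately show "Measurable.pred (PiM A (\<lambda>_. borel)) (\<lambda>f. \<not> (t' i f < c' (Suc m) f \<and> c' (Suc m) f \<le> t' (Suc i) f))"
        by blast
    qed
    have [measurable]: "c' n \<in> borel_measurable (PiM A (\<lambda>_. borel))" "t' k \<in> borel_measurable (PiM A (\<lambda>_. borel))"
      by (auto intro: c'_meas t'_meas)
    have [measurable]: "Measurable.pred (PiM A (\<lambda>_. borel)) (\<lambda>f. c' n f \<le> t' k f)"
      unfolding pred_def by (intro borel_measurable_le c'_meas t'_meas order.refl)
    have F_meas: "F \<in> borel_measurable (PiM A (\<lambda>_. borel))"
      unfolding F_def[abs_def] by measurable
    define R where "R w = F (restrict (\<lambda>i. case_sum X Y i w) A)" for w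
    have c'_eq: "c' m (restrict (\<lambda>i. case_sum X Y i w) A) = ?c m w" if "m \<le> n" for m w
      unfolding c'_def access_time_def using that by (intro sum.cong) (auto simp: A_def)
    have t'_eq: "t' m (restrict (\<lambda>i. case_sum X Y i w) A) = ?t m w" if "m \<le> k" for m w
      unfolding t'_def access_time_def using that by (intro sum.cong) (auto simp: A_def)
    have R_eq: "R w = (if past n w then ?t k w - ?c n w else - 1)" for w
    proof -
      have "E (restrict (\<lambda>i. case_sum X Y i w) A)
          \<longleftrightarrow> (\<forall>i\<in>S. \<forall>m<n. \<not> (?t i w < ?c (Suc m) w \<and> ?c (Suc m) w \<le> ?t (Suc i) w))"
        unfolding E_def Ball_def using S by (auto simp: c'_eq t'_eq subset_eq Suc_le_eq)
      then show ?thesis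
        by (simp add: R_def F_def past_def c'_eq t'_eq)
    qed
    have R_nonneg: "0 \<le> R w \<longleftrightarrow> past n w" for w
      by (auto simp: R_eq past_def)
    have "U n w \<longleftrightarrow> 0 \<le> R w \<and> R w < X n w" "W n w \<longleftrightarrow> 0 \<le> R w \<and> R w + Y k w < X n w" for w
      unfolding U_def W_def R_nonneg by (auto simp: R_eq access_time_def)
    moreover have "prob {w \<in> space M. 0 \<le> R w \<and> R w + Y k w < X n w}
       = ?a * prob {w \<in> space M. 0 \<le> R w \<and> R w < X n w}"
      unfolding R_def by (rule memoryless_step[OF F_meas]) (auto simp: A_def)
    ultimately show ?thesis by simp
  qed
  \<comment> \<open>Almost surely exactly one \<open>N\<close> counts the changes up to
    \<open>t k\<close>, so the events \<open>U n\<close> are disjoint, likewise the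
    \<open>W n\<close>, and their unions are the two events to be compared.\<close>
  have "AE w in M. (\<forall>i\<in>UNIV. \<forall>j\<in>UNIV. U i w \<longrightarrow> U j w \<longrightarrow> i = j)
      \<and> (\<forall>i\<in>UNIV. \<forall>j\<in>UNIV. W i w \<longrightarrow> W j w \<longrightarrow> i = j)
      \<and> ((\<forall>i\<in>S. unchanged X Y i w) \<longleftrightarrow> (\<exists>n\<in>UNIV. U n w))
      \<and> ((\<forall>i\<in>S. unchanged X Y i w) \<and> unchanged X Y k w \<longleftrightarrow> (\<exists>n\<in>UNIV. W n w))"
    using AE_regular
  proof eventually_elim
    case (elim w)
    then have c: "strict_mono (\<lambda>n. ?c n w)" and t: "strict_mono (\<lambda>n. ?t n w)"
      and ub: "\<exists>n. ?t k w < ?c n w" by auto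
    have "?c 0 w \<le> ?t k w" using strict_mono_less_eq[OF t, of 0 k] by (simp add: access_time_def)
    from bracketing_index_exists[of "\<lambda>n. ?c n w", OF this ub]
    obtain N where N: "?c N w \<le> ?t k w" "?t k w < ?c (Suc N) w" by blast
    have U_iff: "U n w \<longleftrightarrow> n = N \<and> past N w" for n
    proof
      assume U: "U n w"
      then have "n = N"
        using bracketing_index_unique[OF c, of n "?t k w" N] N unfolding U_def past_def by blast
      then show "n = N \<and> past N w" using U by (simp add: U_def)
    qed (use N in \<open>simp add: U_def\<close>)
    have tk: "?t k w < ?t (Suc k) w" using strict_monoD[OF t, of k "Suc k"] by simp
    have W_iff: "W n w \<longleftrightarrow> n = N \<and> past N w \<and> ?t (Suc k) w < ?c (Suc N) w" for n
    proof
      assume W: "W n w"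
      then have "U n w" using tk by (simp add: U_def W_def)
      then show "n = N \<and> past N w \<and> ?t (Suc k) w < ?c (Suc N) w"
        using W U_iff[of n] by (simp add: W_def)
    qed (simp add: W_def)
    have past_iff: "(\<forall>i\<in>S. unchanged X Y i w) \<longleftrightarrow> past N w"
    proof
      assume "past N w"
      then show "\<forall>i\<in>S. unchanged X Y i w"
        using interval_counting[OF c strict_mono_mono[OF t] N S] unfolding past_def unchanged_def by blast
    next
      assume "\<forall>i\<in>S. unchanged X Y i w"
      then show "past N w" using N unfolding past_def unchanged_def by blast
    qed
    have "unchanged X Y k w \<longleftrightarrow> ?t (Suc k) w < ?c (Suc N) w"
      using last_interval_empty_iff[OF c, of N "\<lambda>n. ?t n w", OF N] unfolding unchanged_def by (simp add: not_le)
    then show ?case using U_iff W_iff past_iff by auto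
  qed
  then have uniq: "AE w in M. \<forall>i\<in>UNIV. \<forall>j\<in>UNIV. U i w \<longrightarrow> U j w \<longrightarrow> i = j"
      "AE w in M. \<forall>i\<in>UNIV. \<forall>j\<in>UNIV. W i w \<longrightarrow> W j w \<longrightarrow> i = j"
    and ex: "AE w in M. (\<forall>i\<in>S. unchanged X Y i w) \<longleftrightarrow> (\<exists>n\<in>UNIV. U n w)"
      "AE w in M. (\<forall>i\<in>S. unchanged X Y i w) \<and> unchanged X Y k w \<longleftrightarrow> (\<exists>n\<in>UNIV. W n w)"
    unfolding AE_conj_iff by blast+
  have [measurable]: "Measurable.pred M (\<lambda>w. \<forall>i\<in>S. unchanged X Y i w)"
    using finS by measurable
  \<comment> \<open>Countable additivity over \<open>n\<close>, with the series written as an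
    integral over counting measure so that the constant factor can be pulled out.\<close>
  have "ennreal (prob {w \<in> space M. (\<forall>i\<in>S. unchanged X Y i w) \<and> unchanged X Y k w})
      = prob {w \<in> space M. \<exists>n\<in>UNIV. W n w}"
    by (rule arg_cong[where f = ennreal], rule prob_eq_AE[OF ex(2)]) measurable
  also have "\<dots> = (\<integral>\<^sup>+n. prob {w \<in> space M. W n w} \<partial>count_space UNIV)"
    by (rule prob_EX_countable[OF _ _ uniq(2)]) auto
  also have "\<dots> = (\<integral>\<^sup>+n. ennreal ?a * ennreal (prob {w \<in> space M. U n w}) \<partial>count_space UNIV)"
    by (simp add: step ennreal_mult'[OF a0] del: times_divide_eq_left)
  also have "\<dots> = ennreal ?a * (\<integral>\<^sup>+n. prob {w \<in> space M. U n w} \<partial>count_space UNIV)"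
    by (rule nn_integral_cmult) simp
  also have "(\<integral>\<^sup>+n. prob {w \<in> space M. U n w} \<partial>count_space UNIV) = prob {w \<in> space M. \<exists>n\<in>UNIV. U n w}"
    by (rule prob_EX_countable[OF _ _ uniq(1), symmetric]) auto
  also have "\<dots> = ennreal (prob {w \<in> space M. \<forall>i\<in>S. unchanged X Y i w})"
    by (rule arg_cong[where f = ennreal], rule prob_eq_AE[OF ex(1), symmetric]) measurable
  finally show ?thesis
    using a0 by (simp add: ennreal_mult'[OF a0, symmetric] del: times_divide_eq_left)
qed

text \<open>Induction on the largest index, since the one-step formula needs all other indices to be
  smaller.\<close>

lemma prob_all_unchanged:
  "finite S \<Longrightarrow> prob {w \<in> space M. \<forall>i\<in>S. unchanged X Y i w} = (p / (Delta + p)) ^ card S"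
proof (induction S rule: finite_linorder_max_induct)
  case empty
  show ?case by (simp add: prob_space)
next
  case (insert k S)
  have "{w \<in> space M. \<forall>i\<in>insert k S. unchanged X Y i w}
      = {w \<in> space M. (\<forall>i\<in>S. unchanged X Y i w) \<and> unchanged X Y k w}" by auto
  moreover have "S \<subseteq> {..<k}" "k \<notin> S" using insert by auto
  ultimately show ?case
    using prob_unchanged_step[of S k] insert by simp
qed

lemma prob_unchanged: "prob {w \<in> space M. unchanged X Y k w} = p / (Delta + p)"
  using prob_all_unchanged[of "{k}"] by simp

lemma indep_events_unchanged: "indep_events (\<lambda>k. {w \<in> space M. unchanged X Y k w}) UNIV"
proof (rule indep_eventsI)
  fix S :: "nat set" assume S: "finite S" "S \<noteq> {}"
  then have "(\<Inter>k\<in>S. {w \<in> space M. unchanged X Y k w}) = {w \<in> space M. \<forall>i\<in>S. unchanged X Y i w}" by auto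
  then show "prob (\<Inter>k\<in>S. {w \<in> space M. unchanged X Y k w}) = (\<Prod>k\<in>S. prob {w \<in> space M. unchanged X Y k w})"
    using S by (simp add: prob_all_unchanged prob_unchanged)
qed measurable

end

subsection \<open>Almost sure convergence\<close>

theorem theorem3:
  fixes M :: "'a measure"
    and X Y :: "nat \<Rightarrow> 'a \<Rightarrow> real"
    and Delta p om :: real
    and beta :: "int \<Rightarrow> real"
    and eta :: "nat \<Rightarrow> real"
    and zm1 z0 :: real
  assumes "prob_space M"
    and Delta_pos: "Delta > 0" and p_pos: "p > 0" and om_pos: "om > 0"
    and indep: "prob_space.indep_vars M (\<lambda>_. borel) (\<lambda>i. case_sum X Y i) UNIV"
    and X_exp: "\<And>n. distributed M lborel (X n) (\<lambda>x. ennreal (exponential_density Delta x))"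
    and Y_exp: "\<And>n. distributed M lborel (Y n) (\<lambda>x. ennreal (exponential_density p x))"
    and beta_pos: "\<And>k. k \<ge> -1 \<Longrightarrow> beta k > 0"
    and eta_pos: "\<And>k. eta k > 0"
    and steps:
      "(filterlim (\<lambda>n. \<Sum>k<n. beta (int k)) at_top sequentially
         \<and> summable (\<lambda>k. (beta (int k))\<^sup>2)
         \<and> (\<forall>k. beta (int k) = eta k / beta (int k)))
       \<or>
       (filterlim (\<lambda>n. \<Sum>k<n. beta (int k)) at_top sequentially
         \<and> filterlim (\<lambda>n. \<Sum>k<n. eta k / beta (int k)) at_top sequentially
         \<and> summable (\<lambda>k. (beta (int k))\<^sup>2 + (eta k / beta (int k))\<^sup>2)
         \<and> ((\<lambda>k. beta (int k) / (eta k / beta (int k))) \<longlonglongrightarrow> 0))"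
  shows "AE w in M. (\<lambda>k. sam p om beta eta (\<lambda>j. change_ind X Y j w) zm1 z0 k) \<longlonglongrightarrow> Delta"
proof -
  interpret page_process M X Y Delta p
    using assms(1) Delta_pos p_pos indep X_exp Y_exp
    by (intro page_process.intro page_process_axioms.intro)
  define a where "a = p / (Delta + p)"
  define b where "b k = beta (int k)" for k
  define g where "g k = eta k / b k" for k
  define A where "A k = {w \<in> space M. unchanged X Y k w}" for k
  have b0: "b k > 0" for k unfolding b_def by (rule beta_pos) simp
  have g0: "g k > 0" for k using b0 eta_pos by (simp add: g_def)
  have a: "0 \<le> a" "a \<le> 1" using Delta_pos p_pos by (auto simp: a_def)
  have tendsto_0: "f \<longlonglongrightarrow> 0" if "summable (\<lambda>k. (f k)\<^sup>2)" for f :: "nat \<Rightarrow> real"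
    using summable_LIMSEQ_zero[OF that] by simp
  \<comment> \<open>Square summability of \<open>g\<close> feeds the random series in both regimes;
    the pathwise part needs only that the step sizes tend to 0.\<close>
  have steps': "summable (\<lambda>k. (g k)\<^sup>2) \<and>
      ((filterlim (\<lambda>n. \<Sum>k<n. b k) at_top sequentially \<and> b \<longlonglongrightarrow> 0 \<and> g = b)
       \<or> (filterlim (\<lambda>n. \<Sum>k<n. b k) at_top sequentially
         \<and> filterlim (\<lambda>n. \<Sum>k<n. g k) at_top sequentially
         \<and> b \<longlonglongrightarrow> 0 \<and> g \<longlonglongrightarrow> 0 \<and> (\<lambda>k. b k / g k) \<longlonglongrightarrow> 0))"
    using steps unfolding b_def[symmetric] g_def[symmetric]
  proof (elim disjE conjE)
    assume *: "filterlim (\<lambda>n. \<Sum>k<n. b k) at_top sequentially" "summable (\<lambda>k. (b k)\<^sup>2)" "\<forall>k. b k = g k"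
    then have "g = b" by auto
    then show ?thesis using *(1,2) tendsto_0[of b] by simp
  next
    assume *: "filterlim (\<lambda>n. \<Sum>k<n. b k) at_top sequentially" "filterlim (\<lambda>n. \<Sum>k<n. g k) at_top sequentially"
      "summable (\<lambda>k. (b k)\<^sup>2 + (g k)\<^sup>2)" "(\<lambda>k. b k / g k) \<longlonglongrightarrow> 0"
    have "summable (\<lambda>k. (b k)\<^sup>2)" "summable (\<lambda>k. (g k)\<^sup>2)"
      by (rule summable_comparison_test'[OF *(3), of 0]; simp)+
    then show ?thesis using * tendsto_0[of b] tendsto_0[of g] by simp
  qed
  have "AE w in M. summable (\<lambda>k. g k * (indicator (A k) w - a))"
  proof (rule Kolmogorov_convergence)
    show "indep_vars (\<lambda>_. borel) (\<lambda>k w. g k * (indicator (A k) w - a)) UNIV"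
      using indep_events_unchanged unfolding A_def[symmetric]
      by (intro indep_vars_compose2[OF indep_vars_indicator, of A UNIV "\<lambda>k x. g k * (x - a)"]) auto
    \<comment> \<open>Both the indicator and \<open>a\<close> lie in \<open>[0, 1]\<close>, so
      \<open>g\<close> itself serves as the bound \<open>B\<close>.\<close>
    show "\<bar>g k * (indicator (A k) w - a)\<bar> \<le> g k" for k w
      using a g0[of k] by (auto simp: abs_mult indicator_def intro!: mult_left_le)
    show "expectation (\<lambda>w. g k * (indicator (A k) w - a)) = 0" for k
    proof -
      have "A k \<in> events" unfolding A_def by measurable
      then have "expectation (\<lambda>w. indicator (A k) w - a) = prob (A k) - a"
        by (subst Bochner_Integration.integral_diff) (auto simp: prob_space less_top[symmetric] intro!: integrable_real_indicator)
      then show ?thesis using prob_unchanged[of k] by (simp add: A_def a_def)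
    qed
    show "summable (\<lambda>k. (g k)\<^sup>2)" using steps' by simp
  qed
  \<comment> \<open>Membership of \<open>w\<close> in \<open>space M\<close> identifies the
    indicator of \<open>A k\<close> with the truth value of \<open>unchanged\<close>.\<close>
  with AE_space show ?thesis
  proof eventually_elim
    case (elim w)
    let ?pair = "sam_pair p om beta eta (\<lambda>j. change_ind X Y j w) zm1 z0"
    let ?z = "sam p om beta eta (\<lambda>j. change_ind X Y j w) zm1 z0"
    \<comment> \<open>The first component of the pair is the previous iterate, for
      \<open>k = 0\<close> the initial value \<open>zm1\<close>. Dividing by
      \<open>beta (int k - 1)\<close> absorbs the denominator of the momentum coefficient.\<close>
    define x where "x k = (?z k - fst (?pair k)) / beta (int k - 1)" for k
    have xS: "x (Suc k) = (?z (Suc k) - ?z k) / b k" for k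
      by (simp add: x_def sam_def b_def Let_def)
    have zS: "?z (Suc k) = ?z k + eta k * (change_ind X Y (Suc k) w * (?z k + p) - ?z k) + (b k - om * eta k) * x k" for k
      by (simp add: x_def sam_def b_def Let_def)
    have noise: "summable (\<lambda>k. g k * (of_bool (unchanged X Y k w) - p / (Delta + p)))"
      using elim by (simp add: A_def a_def indicator_def)
    have x_rec: "x (Suc k) = (1 - om * g k) * x k + g k * ((1 - of_bool (unchanged X Y k w)) * (?z k + p) - ?z k)" for k
    proof -
      have "(u + e * v + (c - om * e) * y - u) / c = (1 - om * (e / c)) * y + e / c * v"
        if "c > 0" for u v c e y :: real
        using that by (simp add: field_simps)
      from this[OF b0] show ?thesis
        unfolding xS zS change_ind_eq_unchanged g_def .
    qed
    have z_rec: "?z (Suc k) = ?z k + b k * x (Suc k)" for k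
      unfolding xS using b0[of k] by simp
    show "?z \<longlonglongrightarrow> Delta"
      using steps' by (intro heavy_ball_tendsto[OF om_pos p_pos Delta_pos b0 g0 _ noise x_rec z_rec]) blast
  qed
qed

end
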